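(* Let $n\geqslant 8$. Suppose $H$ is a Hadamard matrix of order $n$ whose first row is the all-ones vector, and let $\mathbf L$ be a family of $n-3$ mutually appropriate Latin squares (MALS) of order $n-1$. Then the graph $\Gamma(H;\mathbf L)$ is a Neumaier graph of coherent rank five with parameters \[ (v,k,\lambda;e,s)=\left(n(n-1)(n-3),\ \frac{n^2(n-3)}{2},\ \frac{n(n^2-n-8)}{4};\ \frac{(n-2)^2}{2},\ (n-1)(n-3)\right), \] and its adjacency matrix has spectrum (superscripts denote multiplicities) \[ \left\{\left[\frac{n^2(n-3)}{2}\right]^{1},\ \left[\frac{n(n-3)}{2}\right]^{n-4},\ \left[\frac{n(n-4)}{2}\right]^{(n-1)^2},\ \left[-\frac n2\right]^{(n-1)^2(n-4)},\ [-n]^{(n-2)(n-3)}\right\}. \]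
   Context: Neumaier graphs. All graphs are finite and simple. A graph is $(v,k,\lambda)$-edge-regular if it has $v$ vertices, is $k$-regular, and every adjacent pair of vertices has exactly $\lambda$ common neighbours. A proper non-empty clique $C$ (proper subset of the vertex set) of order $s$ is $e$-regular if every vertex outside $C$ is adjacent to precisely $e>0$ vertices in $C$. A Neumaier graph is a non-complete edge-regular graph containing an $e$-regular clique; it has parameters $(v,k,\lambda;e,s)$ if it is $(v,k,\lambda)$-edge-regular and contains an $e$-regular clique of order $s$. Coherent rank. For a finite set $X$, a coherent algebra on $X$ is a real vector subspace of $\mathbb R^{X\times X}$ that contains the identity matrix $I$ and the all-ones matrix $J$ and is closed under transpose, matrix multiplication, and entrywise multiplication. The coherent closure of a graph on $X$ is the smallest coherent algebra on $X$ containing its adjacency matrix; the coherent rank of the graph is the dimension of its coherent closure as a real vector space. MALS. A Latin square of order $t$ is a $t\times t$ array in which every symbol (from a set of $t$ symbols) occurs exactly once in each row and column. Two Latin squares with the same column set and symbol set are appropriate if each row of one agrees with each row of the other in exactly one column. A family of mutually appropriate Latin squares (MALS) is a pairwise appropriate family. Throughout, a family of MALS of order $n-1$ has row and column labels $\{1,\dots,n-1\}$ and symbol set $\{2,\dots,n\}$. The graph $\Gamma(H;\mathbf L)$. A Hadamard matrix of order $n$ is $H\in\{\pm1\}^{n\times n}$ with $HH^{T}=nI_n$. Let $H$ have rows $h_1=\mathbf 1^{T},h_2,\dots,h_n$ (row vectors), and let $\mathbf L=\{L_1,\dots,L_m\}$, $m\geqslant 3$, be a family of $m$ MALS of order $n-1$.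 For distinct $i,j\in\{1,\dots,m\}$ and row labels $r,s\in\{1,\dots,n-1\}$, let $L_{ij}(r,s)\in\{2,\dots,n\}$ be the common symbol $L_i(r,c)=L_j(s,c)$ in the unique column $c$ for which this equality holds. For $\ell\in\{2,\dots,n\}$ put $\mathfrak H_\ell=h_\ell^{T}h_\ell$, an $n\times n$ matrix. Let \[ \Omega=\{(i,r,x):1\leqslant i\leqslant m,\ 1\leqslant r\leqslant n-1,\ 1\leqslant x\leqslant n\},\qquad \Omega_{i,r}=\{(i,r,x):1\leqslant x\leqslant n\}. \] Define $\{0,1\}$-matrices $A_2,A_4$ indexed by $\Omega$: $A_4=I_m\otimes(J_{n-1}-I_{n-1})\otimes J_n$ (with $J_k$ the $k\times k$ all-ones matrix, tensor factors corresponding to the coordinates $i,r,x$), and, for $i\neq j$ and all $r,s$, the block of $A_2$ with rows $\Omega_{i,r}$ and columns $\Omega_{j,s}$ is $\frac12\left(J_n+\mathfrak H_{L_{ij}(r,s)}\right)$, while all blocks of $A_2$ with $i=j$ are zero. The graph $\Gamma(H;\mathbf L)$ has vertex set $\Omega$ and adjacency matrix $A_2+A_4$. In the theorem, $m=n-3$. *)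

theory Defs
  imports
    "HOL-Library.Function_Algebras"
    "Jordan_Normal_Form.Char_Poly"
    "Graph_Theory.Pair_Digraph"
begin

section \<open>Matrices indexed by an arbitrary finite set\<close>

text \<open>
  A real matrix with rows and columns indexed by \<open>X\<close> is a function \<open>'a \<Rightarrow> 'a \<Rightarrow> real\<close> that
  vanishes outside \<open>X \<times> X\<close>. Functions into a real vector space form a real vector
  space pointwise, so that \<open>subspace\<close> and \<open>dim\<close> apply to sets of such matrices; by
  \<open>Function_Algebras\<close>, \<open>A * B\<close> is the entrywise product.
\<close>

instantiation "fun" :: (type, real_vector) real_vector
begin

definition scaleR_fun :: "real \<Rightarrow> ('a \<Rightarrow> 'b) \<Rightarrow> 'a \<Rightarrow> 'b" where
  "scaleR_fun c f = (\<lambda>x. c *\<^sub>R f x)"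

instance
  by standard (simp_all add: scaleR_fun_def fun_eq_iff scaleR_add_right scaleR_add_left)

end

type_synonym 'a matrix = "'a \<Rightarrow> 'a \<Rightarrow> real"

definition matrices_on :: "'a set \<Rightarrow> 'a matrix set" where
  "matrices_on X = {M. \<forall>x y. (x \<notin> X \<or> y \<notin> X) \<longrightarrow> M x y = 0}"

definition identity_on :: "'a set \<Rightarrow> 'a matrix" where
  "identity_on X = (\<lambda>x y. if x \<in> X \<and> y = x then 1 else 0)"

definition all_ones_on :: "'a set \<Rightarrow> 'a matrix" where
  "all_ones_on X = (\<lambda>x y. if x \<in> X \<and> y \<in> X then 1 else 0)"

definition mmult_on :: "'a set \<Rightarrow> 'a matrix \<Rightarrow> 'a matrix \<Rightarrow> 'a matrix" where
  "mmult_on X A B = (\<lambda>x y. \<Sum>z\<in>X. A x z * B z y)"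

definition list_matrix :: "'a list \<Rightarrow> 'a matrix \<Rightarrow> real mat" where
  "list_matrix vs M = mat (length vs) (length vs) (\<lambda>(i, j). M (vs ! i) (vs ! j))"

text \<open>
  \<open>S\<close> is the spectrum of \<open>M\<close>, eigenvalues being listed with their multiplicity as roots of
  the characteristic polynomial. The latter does not depend on the chosen enumeration \<open>vs\<close>
  of the finite index set.
\<close>

definition has_spectrum :: "'a set \<Rightarrow> 'a matrix \<Rightarrow> real multiset \<Rightarrow> bool" where
  "has_spectrum X M S \<longleftrightarrow>
     (\<forall>vs. distinct vs \<and> set vs = X \<longrightarrow>
        char_poly (list_matrix vs M) = (\<Prod>\<theta>\<in>#S. [:- \<theta>, 1:]))"


section \<open>Coherent rank\<close>

definition coherent_algebra :: "'a set \<Rightarrow> 'a matrix set \<Rightarrow> bool" where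
  "coherent_algebra X \<A> \<longleftrightarrow>
     \<A> \<subseteq> matrices_on X \<and> subspace \<A> \<and>
     identity_on X \<in> \<A> \<and> all_ones_on X \<in> \<A> \<and>
     (\<forall>A\<in>\<A>. (\<lambda>x y. A y x) \<in> \<A>) \<and>
     (\<forall>A\<in>\<A>. \<forall>B\<in>\<A>. mmult_on X A B \<in> \<A>) \<and>
     (\<forall>A\<in>\<A>. \<forall>B\<in>\<A>. A * B \<in> \<A>)"

definition coherent_closure :: "'a set \<Rightarrow> 'a matrix \<Rightarrow> 'a matrix set" where
  "coherent_closure X A = \<Inter> {\<A>. coherent_algebra X \<A> \<and> A \<in> \<A>}"

lemma coherent_algebra_matrices_on: "coherent_algebra X (matrices_on X)"
  unfolding coherent_algebra_def
proof (intro conjI ballI)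
  show "subspace (matrices_on X)"
    by (rule real_vector.subspaceI) (simp_all add: matrices_on_def scaleR_fun_def)
next
  fix A B assume "A \<in> matrices_on X" "B \<in> matrices_on X"
  then show "mmult_on X A B \<in> matrices_on X"
    by (auto simp: matrices_on_def mmult_on_def intro!: sum.neutral)
next
  fix A assume "A \<in> matrices_on X"
  then show "(\<lambda>x y. A y x) \<in> matrices_on X"
    by (auto simp: matrices_on_def)
qed (simp_all add: matrices_on_def identity_on_def all_ones_on_def)

lemma coherent_closure_is_least:
  assumes "A \<in> matrices_on X"
  shows "coherent_algebra X (coherent_closure X A)" and "A \<in> coherent_closure X A"
    and "coherent_algebra X \<A> \<Longrightarrow> A \<in> \<A> \<Longrightarrow> coherent_closure X A \<subseteq> \<A>"
proof -
  show "coherent_algebra X (coherent_closure X A)"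
    unfolding coherent_algebra_def
  proof (intro conjI)
    show "coherent_closure X A \<subseteq> matrices_on X"
      using coherent_algebra_matrices_on[of X] assms
      unfolding coherent_closure_def by blast
    show "subspace (coherent_closure X A)"
      unfolding coherent_closure_def
      by (rule real_vector.subspace_Inter) (simp add: coherent_algebra_def)
  qed (simp_all add: coherent_closure_def coherent_algebra_def)
qed (auto simp: coherent_closure_def)


section \<open>Neumaier graphs\<close>

text \<open>
  Finite simple graphs are the \<open>pair_graph\<close>s of the library: finite, loopless, and with a
  symmetric set of arcs.
\<close>

definition adjacency_matrix :: "'a pair_pre_digraph \<Rightarrow> 'a matrix" where
  "adjacency_matrix G = (\<lambda>x y. if (x, y) \<in> parcs G then 1 else 0)"

definition coherent_rank :: "'a pair_pre_digraph \<Rightarrow> nat" where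
  "coherent_rank G = dim (coherent_closure (pverts G) (adjacency_matrix G))"

definition complete_graph :: "'a pair_pre_digraph \<Rightarrow> bool" where
  "complete_graph G \<longleftrightarrow> (\<forall>x\<in>pverts G. \<forall>y\<in>pverts G. x \<noteq> y \<longrightarrow> (x, y) \<in> parcs G)"

definition edge_regular :: "'a pair_pre_digraph \<Rightarrow> nat \<Rightarrow> nat \<Rightarrow> nat \<Rightarrow> bool" where
  "edge_regular G v k l \<longleftrightarrow>
     pair_graph G \<and> card (pverts G) = v \<and>
     (\<forall>x\<in>pverts G. card {y \<in> pverts G. (x, y) \<in> parcs G} = k) \<and>
     (\<forall>(x, y)\<in>parcs G. card {z \<in> pverts G. (x, z) \<in> parcs G \<and> (y, z) \<in> parcs G} = l)"

definition regular_clique :: "'a pair_pre_digraph \<Rightarrow> nat \<Rightarrow> nat \<Rightarrow> 'a set \<Rightarrow> bool" where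
  "regular_clique G e s C \<longleftrightarrow>
     C \<subset> pverts G \<and> C \<noteq> {} \<and> card C = s \<and>
     (\<forall>x\<in>C. \<forall>y\<in>C. x \<noteq> y \<longrightarrow> (x, y) \<in> parcs G) \<and>
     e > 0 \<and> (\<forall>x\<in>pverts G - C. card {y \<in> C. (x, y) \<in> parcs G} = e)"

definition neumaier_graph ::
  "'a pair_pre_digraph \<Rightarrow> nat \<Rightarrow> nat \<Rightarrow> nat \<Rightarrow> nat \<Rightarrow> nat \<Rightarrow> bool" where
  "neumaier_graph G v k l e s \<longleftrightarrow>
     edge_regular G v k l \<and> \<not> complete_graph G \<and> (\<exists>C. regular_clique G e s C)"


section \<open>Mutually appropriate Latin squares\<close>

text \<open>The entry of \<open>L\<close> in row \<open>r\<close> and column \<open>c\<close> is \<open>L r c\<close>.\<close>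

definition latin_square ::
  "nat \<Rightarrow> nat set \<Rightarrow> nat set \<Rightarrow> nat set \<Rightarrow> (nat \<Rightarrow> nat \<Rightarrow> nat) \<Rightarrow> bool" where
  "latin_square t R C S L \<longleftrightarrow>
     finite R \<and> finite C \<and> finite S \<and> card R = t \<and> card C = t \<and> card S = t \<and>
     (\<forall>r\<in>R. \<forall>c\<in>C. L r c \<in> S) \<and>
     (\<forall>r\<in>R. \<forall>a\<in>S. \<exists>!c. c \<in> C \<and> L r c = a) \<and>
     (\<forall>c\<in>C. \<forall>a\<in>S. \<exists>!r. r \<in> R \<and> L r c = a)"

definition appropriate ::
  "nat set \<Rightarrow> nat set \<Rightarrow> (nat \<Rightarrow> nat \<Rightarrow> nat) \<Rightarrow> (nat \<Rightarrow> nat \<Rightarrow> nat) \<Rightarrow> bool" where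
  "appropriate R C L M \<longleftrightarrow> (\<forall>r\<in>R. \<forall>s\<in>R. \<exists>!c. c \<in> C \<and> L r c = M s c)"

text \<open>
  \<open>L 1, \<dots>, L m\<close> is a family of \<open>m\<close> MALS of order \<open>n - 1\<close>, with rows and columns labelled
  by \<open>{1..n-1}\<close> and symbols \<open>{2..n}\<close>.
\<close>

definition MALS :: "nat \<Rightarrow> nat \<Rightarrow> (nat \<Rightarrow> nat \<Rightarrow> nat \<Rightarrow> nat) \<Rightarrow> bool" where
  "MALS n m L \<longleftrightarrow>
     (\<forall>i\<in>{1..m}. latin_square (n - 1) {1..n - 1} {1..n - 1} {2..n} (L i)) \<and>
     (\<forall>i\<in>{1..m}. \<forall>j\<in>{1..m}. i \<noteq> j \<longrightarrow> appropriate {1..n - 1} {1..n - 1} (L i) (L j))"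

definition common_symbol ::
  "nat \<Rightarrow> (nat \<Rightarrow> nat \<Rightarrow> nat \<Rightarrow> nat) \<Rightarrow> nat \<Rightarrow> nat \<Rightarrow> nat \<Rightarrow> nat \<Rightarrow> nat" where
  "common_symbol n L i j r s = L i r (THE c. c \<in> {1..n - 1} \<and> L i r c = L j s c)"


section \<open>The graph of a Hadamard matrix and a family of MALS\<close>

definition hadamard_matrix :: "nat \<Rightarrow> real mat \<Rightarrow> bool" where
  "hadamard_matrix n H \<longleftrightarrow>
     H \<in> carrier_mat n n \<and> (\<forall>i<n. \<forall>j<n. H $$ (i, j) \<in> {1, -1}) \<and>
     H * transpose_mat H = of_nat n \<cdot>\<^sub>m 1\<^sub>m n"

text \<open>
  \<open>mat\<close> indices start at 0, whereas rows and columns of \<open>H\<close> are numbered from 1 in the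
  construction: the row \<open>h\<^sub>a\<close> is \<open>row H (a - 1)\<close>. The following is \<open>h\<^sub>a\<^sup>T h\<^sub>a\<close>.
\<close>

definition rank_one_matrix :: "real mat \<Rightarrow> nat \<Rightarrow> nat matrix" where
  "rank_one_matrix H a = (\<lambda>x y. row H (a - 1) $ (x - 1) * row H (a - 1) $ (y - 1))"

definition Omega :: "nat \<Rightarrow> nat \<Rightarrow> (nat \<times> nat \<times> nat) set" where
  "Omega n m = {1..m} \<times> {1..n - 1} \<times> {1..n}"

definition A2 ::
  "nat \<Rightarrow> nat \<Rightarrow> real mat \<Rightarrow> (nat \<Rightarrow> nat \<Rightarrow> nat \<Rightarrow> nat) \<Rightarrow> (nat \<times> nat \<times> nat) matrix" where
  "A2 n m H L = (\<lambda>(i, r, x) (j, s, y).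
     if (i, r, x) \<in> Omega n m \<and> (j, s, y) \<in> Omega n m \<and> i \<noteq> j
     then (1 + rank_one_matrix H (common_symbol n L i j r s) x y) / 2 else 0)"

text \<open>Entrywise form of \<open>I\<^sub>m \<otimes> (J\<^sub>n\<^sub>-\<^sub>1 - I\<^sub>n\<^sub>-\<^sub>1) \<otimes> J\<^sub>n\<close>:\<close>

definition A4 :: "nat \<Rightarrow> nat \<Rightarrow> (nat \<times> nat \<times> nat) matrix" where
  "A4 n m = (\<lambda>(i, r, x) (j, s, y).
     if (i, r, x) \<in> Omega n m \<and> (j, s, y) \<in> Omega n m \<and> i = j \<and> r \<noteq> s then 1 else 0)"

definition Gamma ::
  "nat \<Rightarrow> nat \<Rightarrow> real mat \<Rightarrow> (nat \<Rightarrow> nat \<Rightarrow> nat \<Rightarrow> nat) \<Rightarrow> (nat \<times> nat \<times> nat) pair_pre_digraph" where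
  "Gamma n m H L =
     \<lparr> pverts = Omega n m,
       parcs = {(u, v). u \<in> Omega n m \<and> v \<in> Omega n m \<and> (A2 n m H L + A4 n m) u v = 1} \<rparr>"

lemma common_symbol_range:
  assumes "MALS n m L" "i \<in> {1..m}" "j \<in> {1..m}" "i \<noteq> j" "r \<in> {1..n - 1}" "s \<in> {1..n - 1}"
  shows "common_symbol n L i j r s \<in> {2..n}"
proof -
  have app: "appropriate {1..n - 1} {1..n - 1} (L i) (L j)"
    using assms(1-4) unfolding MALS_def by blast
  have ls: "latin_square (n - 1) {1..n - 1} {1..n - 1} {2..n} (L i)"
    using assms(1,2) unfolding MALS_def by blast
  have "\<exists>!c. c \<in> {1..n - 1} \<and> L i r c = L j s c"
    using app[unfolded appropriate_def, rule_format, OF assms(5,6)] .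
  from theI'[OF this] have "(THE c. c \<in> {1..n - 1} \<and> L i r c = L j s c) \<in> {1..n - 1}" ..
  moreover have "\<forall>c\<in>{1..n - 1}. L i r c \<in> {2..n}"
    using ls assms(5) unfolding latin_square_def by blast
  ultimately show ?thesis
    unfolding common_symbol_def by blast
qed

lemma adjacency_matrix_Gamma:
  assumes H: "hadamard_matrix n H" and L: "MALS n m L"
  shows "adjacency_matrix (Gamma n m H L) = A2 n m H L + A4 n m"
proof (intro ext)
  fix u v :: "nat \<times> nat \<times> nat"
  obtain i r x j s y where uv: "u = (i, r, x)" "v = (j, s, y)"
    by (metis prod_cases3)
  let ?inside = "u \<in> Omega n m \<and> v \<in> Omega n m"
  let ?q = "rank_one_matrix H (common_symbol n L i j r s) x y"
  have entry: "(A2 n m H L + A4 n m) u v =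
      (if ?inside \<and> i \<noteq> j then (1 + ?q) / 2 else 0) + (if ?inside \<and> i = j \<and> r \<noteq> s then 1 else 0)"
    unfolding uv A2_def A4_def plus_fun_def prod.case by (simp only: conj_assoc)
  have q: "?q = 1 \<or> ?q = -1" if inside: ?inside and "i \<noteq> j"
  proof -
    define l where "l = common_symbol n L i j r s"
    have mem: "i \<in> {1..m}" "j \<in> {1..m}" "r \<in> {1..n - 1}" "s \<in> {1..n - 1}" "x \<in> {1..n}" "y \<in> {1..n}"
      using inside unfolding uv Omega_def by simp_all
    have "l \<in> {2..n}"
      unfolding l_def by (rule common_symbol_range[OF L mem(1,2) \<open>i \<noteq> j\<close> mem(3,4)])
    then have lt: "l - 1 < n" "x - 1 < n" "y - 1 < n"
      using mem(5,6) by auto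
    have HC: "H \<in> carrier_mat n n"
      and ent: "\<forall>a<n. \<forall>b<n. H $$ (a, b) \<in> {1, -1}"
      using H unfolding hadamard_matrix_def by blast+
    have eq: "rank_one_matrix H l x y = H $$ (l - 1, x - 1) * H $$ (l - 1, y - 1)"
      using carrier_matD[OF HC] lt unfolding rank_one_matrix_def by (simp only: index_row)
    have "H $$ (l - 1, x - 1) \<in> {1, -1}" "H $$ (l - 1, y - 1) \<in> {1, -1}"
      using ent lt by blast+
    then show ?thesis
      unfolding l_def[symmetric] eq by (elim insertE emptyE) simp_all
  qed
  have zero_one: "(A2 n m H L + A4 n m) u v = (if ?inside \<and> (A2 n m H L + A4 n m) u v = 1 then 1 else 0)"
  proof (cases "?inside \<and> i \<noteq> j")
    case True
    with q have "?q = 1 \<or> ?q = -1"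
      by blast
    with True show ?thesis
      unfolding entry by (elim disjE) simp_all
  next
    case False
    then show ?thesis
      unfolding entry by (simp only: simp_thms if_False) (simp split: if_split)
  qed
  show "adjacency_matrix (Gamma n m H L) u v = (A2 n m H L + A4 n m) u v"
    unfolding adjacency_matrix_def Gamma_def pair_pre_digraph.simps mem_Collect_eq prod.case
    using zero_one by (simp only: conj_assoc)
qed

end

theory Submission
  imports Defs "Jordan_Normal_Form.Schur_Decomposition"
begin

text \<open>
  Write \<open>A\<^sub>2 = (J - C2 + N) / 2\<close> and \<open>A\<^sub>4 = C2 - C1\<close>, where \<open>C1\<close> and \<open>C2\<close> are the block matrices of
  ``equal first two coordinates'' and ``equal first coordinate'', and the blocks of \<open>N\<close> are the
  \<open>h\<^sub>a\<^sup>T h\<^sub>a\<close>. The rows \<open>h\<^sub>a\<close> with \<open>a \<ge> 2\<close> have sum zero, so \<open>N\<close> annihilates \<open>C1\<close>, \<open>C2\<close> and \<open>J\<close>.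
  For a fixed symbol \<open>a\<close>, the pairs of a square and a row are partitioned by the column in which \<open>a\<close> occurs;
  thus the \<open>a\<close>-part of \<open>N\<close> is a disjoint union of complete graphs on \<open>m\<close> vertices tensored with
  \<open>h\<^sub>a\<^sup>T h\<^sub>a\<close>, and \<open>N\<^sup>2\<close> is a combination of \<open>N\<close>, \<open>I\<close> and \<open>C1\<close>. Hence \<open>I, J, C1, C2, N\<close> span a
  coherent algebra. For \<open>m = n - 3\<close> the matrix \<open>C1\<close> is a combination of \<open>A\<^sup>2, A, J, I\<close>, and then \<open>C2\<close> is one
  of \<open>C1 A, C1, J\<close>, so \<open>A\<close> generates the whole algebra. The vertices with last coordinate 1 form the
  regular clique. The algebra contains explicit projections \<open>E\<^sub>k\<close> with \<open>E\<^sub>k A = \<theta>\<^sub>k E\<^sub>k\<close> and sum \<open>I\<close>;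
  their traces give the traces of all powers of \<open>A\<close>, and these determine the characteristic polynomial.
\<close>

section \<open>The characteristic polynomial from the traces of powers\<close>

lemma sum_mset_eq_count_mult:
  fixes f :: "'a \<Rightarrow> 'b::semiring_1"
  assumes "\<And>x. x \<in># A \<Longrightarrow> x \<noteq> a \<Longrightarrow> f x = 0"
  shows "(\<Sum>x\<in>#A. f x) = of_nat (count A a) * f a"
  using assms
proof (induction A)
  case (add x A)
  then show ?case by (cases "x = a") (auto simp: algebra_simps)
qed simp

lemma sum_mset_poly:
  fixes A :: "'a::comm_ring_1 multiset"
  shows "(\<Sum>x\<in>#A. poly p x) = (\<Sum>i\<le>degree p. coeff p i * (\<Sum>x\<in>#A. x ^ i))"
  by (induction A) (simp_all add: poly_altdef distrib_left sum.distrib)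

text \<open>Equal power sums give equal sums of every polynomial. A polynomial vanishing at all
  elements except \<open>a\<close> picks out the multiplicity of \<open>a\<close>, and
  characteristic zero allows comparing the two multiplicities.\<close>

lemma multiset_eq_of_power_sums:
  fixes A B :: "'a::field_char_0 multiset"
  assumes "\<And>k. (\<Sum>x\<in>#A. x ^ k) = (\<Sum>x\<in>#B. x ^ k)"
  shows "A = B"
proof (rule multiset_eqI)
  fix a
  define Z where "Z = (set_mset A \<union> set_mset B) - {a}"
  define p where "p = (\<Prod>c\<in>Z. [:- c, 1:])"
  have poly_p: "poly p x = (\<Prod>c\<in>Z. x - c)" for x
    by (simp add: p_def poly_prod)
  have "finite Z" by (simp add: Z_def)
  then have zero: "poly p x = 0" if "x \<in> Z" for x
    using that by (auto simp: poly_p)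
  have "poly p a \<noteq> 0"
    using \<open>finite Z\<close> by (auto simp: poly_p Z_def)
  have "(\<Sum>x\<in>#A. poly p x) = (\<Sum>x\<in>#B. poly p x)"
    by (simp add: sum_mset_poly assms)
  moreover have "(\<Sum>x\<in>#A. poly p x) = of_nat (count A a) * poly p a"
    by (rule sum_mset_eq_count_mult) (auto intro: zero simp: Z_def)
  moreover have "(\<Sum>x\<in>#B. poly p x) = of_nat (count B a) * poly p a"
    by (rule sum_mset_eq_count_mult) (auto intro: zero simp: Z_def)
  ultimately show "count A a = count B a"
    using \<open>poly p a \<noteq> 0\<close> by simp
qed

lemma upper_triangular_pow:
  assumes T: "T \<in> carrier_mat N N" and tri: "upper_triangular T"
  shows "upper_triangular (T ^\<^sub>m k) \<and> (\<forall>i<N. (T ^\<^sub>m k) $$ (i, i) = (T $$ (i, i)) ^ k)"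
proof (induction k)
  case 0
  then show ?case using T by auto
next
  case (Suc k)
  let ?P = "T ^\<^sub>m k"
  have P: "?P \<in> carrier_mat N N" using T by simp
  have entry: "(?P * T) $$ (i, j) = (\<Sum>l<N. ?P $$ (i, l) * T $$ (l, j))" if "i < N" "j < N" for i j
    using T P that by (simp add: scalar_prod_def atLeast0LessThan)
  have vanish: "?P $$ (i, l) * T $$ (l, j) = 0" if "i < N" "j < N" "l < N" "l < i \<or> j < l" for i j l
    using that Suc T P tri by (auto simp: upper_triangular_def)
  have "(?P * T) $$ (i, j) = 0" if "j < i" "i < N" for i j
    using that by (subst entry) (auto intro!: sum.neutral vanish)
  moreover have "(?P * T) $$ (i, i) = (T $$ (i, i)) ^ Suc k" if "i < N" for i
  proof -
    have "(?P * T) $$ (i, i) = (\<Sum>l<N. if l = i then ?P $$ (i, i) * T $$ (i, i) else 0)"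
      unfolding entry[OF that that]
      by (rule sum.cong) (use vanish that in \<open>auto simp: neq_iff\<close>)
    with that Suc show ?thesis by (simp add: power_commutes)
  qed
  ultimately show ?case using P T by (auto simp: upper_triangular_def)
qed

lemma trace_mult_commute:
  fixes A B :: "'a::comm_ring_1 mat"
  assumes "A \<in> carrier_mat N N" "B \<in> carrier_mat N N"
  shows "(\<Sum>i<N. (A * B) $$ (i, i)) = (\<Sum>i<N. (B * A) $$ (i, i))"
proof -
  have "(\<Sum>i<N. (A * B) $$ (i, i)) = (\<Sum>i<N. \<Sum>j<N. A $$ (i, j) * B $$ (j, i))"
    using assms by (simp add: scalar_prod_def atLeast0LessThan)
  also have "\<dots> = (\<Sum>j<N. \<Sum>i<N. B $$ (j, i) * A $$ (i, j))"
    by (subst sum.swap) (simp add: mult.commute)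
  also have "\<dots> = (\<Sum>i<N. (B * A) $$ (i, i))"
    using assms by (simp add: scalar_prod_def atLeast0LessThan)
  finally show ?thesis .
qed

text \<open>Schur decomposition gives \<open>M = P T Q\<close> with \<open>Q P = 1\<close> and
  \<open>T\<close> upper triangular with diagonal \<open>as\<close>; cyclicity of the trace removes
  \<open>P\<close> and \<open>Q\<close>.\<close>

lemma trace_pow_eq_sum_eigenvalues:
  fixes M :: "complex mat"
  assumes M: "M \<in> carrier_mat N N" and cp: "char_poly M = (\<Prod>a\<leftarrow>as. [:- a, 1:])"
  shows "(\<Sum>i<N. (M ^\<^sub>m k) $$ (i, i)) = (\<Sum>a\<in>#mset as. a ^ k)"
proof -
  obtain T P Q where S: "schur_decomposition M as = (T, P, Q)"
    by (cases "schur_decomposition M as")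
  from schur_decomposition[OF M cp S]
  have wit: "similar_mat_wit M T P Q" and tri: "upper_triangular T" and diag: "diag_mat T = as"
    by auto
  from similar_mat_witD2[OF M wit]
  have QP: "Q * P = 1\<^sub>m N" and T: "T \<in> carrier_mat N N"
    and P: "P \<in> carrier_mat N N" and Q: "Q \<in> carrier_mat N N" by auto
  have Tk: "T ^\<^sub>m k \<in> carrier_mat N N" using T by simp
  have "(\<Sum>i<N. (M ^\<^sub>m k) $$ (i, i)) = (\<Sum>i<N. (P * (T ^\<^sub>m k * Q)) $$ (i, i))"
    using similar_mat_wit_pow_id[OF wit, of k] P Tk Q by simp
  also have "\<dots> = (\<Sum>i<N. (T ^\<^sub>m k * Q * P) $$ (i, i))"
    by (rule trace_mult_commute) (use P Tk Q in auto)
  also have "T ^\<^sub>m k * Q * P = T ^\<^sub>m k"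
    using assoc_mult_mat[OF Tk Q P] right_mult_one_mat[OF Tk] by (simp add: QP)
  also have "(\<Sum>i<N. (T ^\<^sub>m k) $$ (i, i)) = (\<Sum>i<N. (T $$ (i, i)) ^ k)"
    using upper_triangular_pow[OF T tri] by simp
  also have "\<dots> = (\<Sum>a\<leftarrow>as. a ^ k)"
    using T by (simp add: diag[symmetric] diag_mat_def o_def sum_list_distinct_conv_sum_set
        atLeast0LessThan)
  finally show ?thesis by (simp add: sum_mset_sum_list[symmetric] del: sum_mset_sum_list)
qed

text \<open>A real characteristic polynomial need not split, so the argument passes to the complex
  numbers. There the roots have the same power sums as \<open>S\<close>, hence they are
  \<open>S\<close>, and the embedding of real polynomials is injective.\<close>

lemma char_poly_eq_of_power_traces:
  fixes M :: "real mat"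
  assumes M: "M \<in> carrier_mat N N"
    and tr: "\<And>k. (\<Sum>i<N. (M ^\<^sub>m k) $$ (i, i)) = (\<Sum>\<theta>\<in>#S. \<theta> ^ k)"
  shows "char_poly M = (\<Prod>\<theta>\<in>#S. [:- \<theta>, 1:])"
proof -
  let ?c = "map_mat complex_of_real"
  have cM: "?c M \<in> carrier_mat N N" using M by simp
  from char_poly_factorized[OF cM] obtain as where cp: "char_poly (?c M) = (\<Prod>a\<leftarrow>as. [:- a, 1:])"
    by blast
  have "mset as = image_mset complex_of_real S"
  proof (rule multiset_eq_of_power_sums)
    fix k
    have "(\<Sum>a\<in>#mset as. a ^ k) = (\<Sum>i<N. (?c (M ^\<^sub>m k)) $$ (i, i))"
      unfolding of_real_hom.mat_hom_pow[OF M] trace_pow_eq_sum_eigenvalues[OF cM cp] ..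
    also have "\<dots> = complex_of_real (\<Sum>i<N. (M ^\<^sub>m k) $$ (i, i))"
      using carrier_matD[OF pow_carrier_mat[OF M, of k]] by simp
    also have "\<dots> = (\<Sum>\<theta>\<in>#S. complex_of_real \<theta> ^ k)"
      unfolding tr by (induction S) simp_all
    finally show "(\<Sum>a\<in>#mset as. a ^ k) = (\<Sum>a\<in>#image_mset complex_of_real S. a ^ k)"
      by (simp add: image_mset.compositionality o_def)
  qed
  then have "char_poly (?c M) = (\<Prod>\<theta>\<in>#S. [:- complex_of_real \<theta>, 1:])"
    unfolding cp prod_mset_prod_list[symmetric] mset_map
    by (simp add: image_mset.compositionality o_def)
  also have "\<dots> = map_poly complex_of_real (\<Prod>\<theta>\<in>#S. [:- \<theta>, 1:])"
  proof (induction S)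
    case (add \<theta> S)
    interpret map_poly_hom: map_poly_comm_ring_hom complex_of_real ..
    from add show ?case
      by (simp add: map_poly_hom.hom_mult of_real_hom.map_poly_pCons_hom del: mult_pCons_left)
  qed simp
  finally have "map_poly complex_of_real (char_poly M) =
      map_poly complex_of_real (\<Prod>\<theta>\<in>#S. [:- \<theta>, 1:])"
    unfolding of_real_hom.char_poly_hom[OF M] .
  then show ?thesis
    by (simp add: poly_eq_iff coeff_map_poly)
qed

text \<open>Multiplying the decomposition of the identity by \<open>M\<close> repeatedly gives the
  \<open>p\<close>-th power of \<open>M\<close> as the sum of the \<open>\<theta> k ^ p\<close>
  multiples of \<open>E k\<close>. Its trace is the power sum of the claimed spectrum.\<close>

lemma has_spectrum_of_eigenmatrices:
  fixes M :: "'a matrix" and E :: "'k \<Rightarrow> 'a matrix"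
  assumes "finite K"
    and eig: "\<And>k x y. k \<in> K \<Longrightarrow> x \<in> X \<Longrightarrow> y \<in> X \<Longrightarrow> mmult_on X (E k) M x y = \<theta> k * E k x y"
    and id: "\<And>x y. x \<in> X \<Longrightarrow> y \<in> X \<Longrightarrow> (\<Sum>k\<in>K. E k x y) = (if x = y then 1 else 0)"
    and tr: "\<And>k. k \<in> K \<Longrightarrow> (\<Sum>x\<in>X. E k x x) = real (d k)"
  shows "has_spectrum X M (\<Sum>k\<in>K. replicate_mset (d k) (\<theta> k))"
  unfolding has_spectrum_def
proof (intro allI impI)
  fix vs assume vs: "distinct vs \<and> set vs = X"
  define N where "N = length vs"
  let ?M = "list_matrix vs M"
  have bij: "bij_betw (\<lambda>i. vs ! i) {..<N} X"
    using vs bij_betw_nth[of vs "{..<N}" X] by (simp add: N_def)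
  have in_X: "vs ! i \<in> X" if "i < N" for i
    using vs that by (auto simp: N_def)
  have M: "?M \<in> carrier_mat N N" by (simp add: list_matrix_def N_def)
  have pow: "(?M ^\<^sub>m p) $$ (i, j) = (\<Sum>k\<in>K. \<theta> k ^ p * E k (vs ! i) (vs ! j))"
    if "i < N" "j < N" for p i j
    using that
  proof (induction p arbitrary: i j)
    case 0
    then show ?case
      using vs by (simp add: id in_X N_def nth_eq_iff_index_eq list_matrix_def)
  next
    case (Suc p)
    have "(?M ^\<^sub>m Suc p) $$ (i, j) = (\<Sum>l<N. (?M ^\<^sub>m p) $$ (i, l) * ?M $$ (l, j))"
      using pow_carrier_mat[OF M, of p] M Suc.prems by (simp add: scalar_prod_def atLeast0LessThan)
    also have "\<dots> = (\<Sum>l<N. \<Sum>k\<in>K. \<theta> k ^ p * (E k (vs ! i) (vs ! l) * M (vs ! l) (vs ! j)))"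
      using Suc by (intro sum.cong) (simp_all add: sum_distrib_right list_matrix_def N_def mult.assoc)
    also have "\<dots> = (\<Sum>k\<in>K. \<theta> k ^ p * (\<Sum>l<N. E k (vs ! i) (vs ! l) * M (vs ! l) (vs ! j)))"
      by (subst sum.swap) (simp add: sum_distrib_left)
    also have "\<dots> = (\<Sum>k\<in>K. \<theta> k ^ p * mmult_on X (E k) M (vs ! i) (vs ! j))"
      unfolding mmult_on_def by (subst sum.reindex_bij_betw[OF bij]) (rule refl)
    also have "\<dots> = (\<Sum>k\<in>K. \<theta> k ^ Suc p * E k (vs ! i) (vs ! j))"
      using Suc.prems by (intro sum.cong) (simp_all add: eig in_X)
    finally show ?case .
  qed
  show "char_poly ?M = (\<Prod>\<theta>\<in>#(\<Sum>k\<in>K. replicate_mset (d k) (\<theta> k)). [:- \<theta>, 1:])"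
  proof (rule char_poly_eq_of_power_traces[OF M])
    fix p
    have "(\<Sum>i<N. (?M ^\<^sub>m p) $$ (i, i)) = (\<Sum>k\<in>K. \<theta> k ^ p * (\<Sum>i<N. E k (vs ! i) (vs ! i)))"
      by (simp add: pow sum_distrib_left) (rule sum.swap)
    also have "\<dots> = (\<Sum>k\<in>K. \<theta> k ^ p * d k)"
      using sum.reindex_bij_betw[OF bij, of "\<lambda>x. E _ x x"] by (simp add: tr)
    also have "\<dots> = (\<Sum>\<theta>\<in>#(\<Sum>k\<in>K. replicate_mset (d k) (\<theta> k)). \<theta> ^ p)"
      using \<open>finite K\<close> by induction (simp_all add: sum_mset_replicate_mset)
    finally show "(\<Sum>i<N. (?M ^\<^sub>m p) $$ (i, i)) = \<dots>" .
  qed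
qed


section \<open>Matrix algebras\<close>

lemma scaleR_matrix_apply [simp]: "(c *\<^sub>R M) x y = c * M x y" for M :: "'a matrix"
  by (simp add: scaleR_fun_def)

lemma mmult_on_add_left: "mmult_on X (A + B) C = mmult_on X A C + mmult_on X B C"
  by (simp add: mmult_on_def fun_eq_iff algebra_simps sum.distrib)

lemma mmult_on_add_right: "mmult_on X A (B + C) = mmult_on X A B + mmult_on X A C"
  by (simp add: mmult_on_def fun_eq_iff algebra_simps sum.distrib)

lemma mmult_on_diff_left: "mmult_on X (A - B) C = mmult_on X A C - mmult_on X B C"
  by (simp add: mmult_on_def fun_eq_iff algebra_simps sum_subtractf)

lemma mmult_on_diff_right: "mmult_on X A (B - C) = mmult_on X A B - mmult_on X A C"
  by (simp add: mmult_on_def fun_eq_iff algebra_simps sum_subtractf)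

lemma mmult_on_scaleR_left: "mmult_on X (c *\<^sub>R A) B = c *\<^sub>R mmult_on X A B"
  by (simp add: mmult_on_def fun_eq_iff sum_distrib_left mult_ac)

lemma mmult_on_scaleR_right: "mmult_on X A (c *\<^sub>R B) = c *\<^sub>R mmult_on X A B"
  by (simp add: mmult_on_def fun_eq_iff sum_distrib_left mult_ac)

lemmas mmult_on_linear =
  mmult_on_add_left mmult_on_add_right mmult_on_diff_left mmult_on_diff_right
  mmult_on_scaleR_left mmult_on_scaleR_right

lemma mmult_on_identity_left:
  assumes "finite X" "M \<in> matrices_on X"
  shows "mmult_on X (identity_on X) M = M"
proof (intro ext)
  fix x y
  have "mmult_on X (identity_on X) M x y = (\<Sum>z\<in>X. if z = x then M x y else 0)"
    unfolding mmult_on_def by (rule sum.cong) (auto simp: identity_on_def)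
  then show "mmult_on X (identity_on X) M x y = M x y"
    using assms by (auto simp: matrices_on_def)
qed

lemma mmult_on_identity_right:
  assumes "finite X" "M \<in> matrices_on X"
  shows "mmult_on X M (identity_on X) = M"
proof (intro ext)
  fix x y
  have "mmult_on X M (identity_on X) x y = (\<Sum>z\<in>X. if z = y then M x y else 0)"
    unfolding mmult_on_def by (rule sum.cong) (auto simp: identity_on_def)
  then show "mmult_on X M (identity_on X) x y = M x y"
    using assms by (auto simp: matrices_on_def)
qed

text \<open>A linear map that sends \<open>S\<close> into \<open>span S\<close> sends
  \<open>span S\<close> into itself. This is applied to the first argument with the second a
  generator, then to the second argument.\<close>

lemma bilinear_closed_span:
  fixes f :: "'v::real_vector \<Rightarrow> 'v \<Rightarrow> 'v"
  assumes gen: "\<And>a b. a \<in> S \<Longrightarrow> b \<in> S \<Longrightarrow> f a b \<in> span S"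
    and left: "\<And>b. linear (\<lambda>a. f a b)" and right: "\<And>a. linear (f a)"
    and "a \<in> span S" "b \<in> span S"
  shows "f a b \<in> span S"
proof -
  have step: "g c \<in> span S" if "linear g" "\<And>d. d \<in> S \<Longrightarrow> g d \<in> span S" "c \<in> span S" for g c
  proof -
    have "g ` span S = span (g ` S)"
      by (simp add: linear_span_image that(1))
    also have "\<dots> \<subseteq> span S"
      by (rule span_minimal) (use that in \<open>auto simp: subspace_span\<close>)
    finally show ?thesis using that(3) by blast
  qed
  have "f a d \<in> span S" if "d \<in> S" for d
    by (rule step[OF left gen \<open>a \<in> span S\<close>]) (use that in auto)
  then show ?thesis
    by (rule step[OF right _ \<open>b \<in> span S\<close>])
qed

section \<open>Colour classes and block matrices\<close>

definition relation_matrix :: "'a set \<Rightarrow> ('a \<Rightarrow> 'a \<Rightarrow> 'k) \<Rightarrow> 'k \<Rightarrow> 'a matrix" where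
  "relation_matrix X c k = (\<lambda>x y. if x \<in> X \<and> y \<in> X \<and> c x y = k then 1 else 0)"

text \<open>Colour classes are disjoint, so the entrywise product of two generators is a generator
  or zero; bilinearity does the rest.\<close>

lemma span_relation_matrices_times_closed:
  assumes "A \<in> span (relation_matrix X c ` K)" "B \<in> span (relation_matrix X c ` K)"
  shows "A * B \<in> span (relation_matrix X c ` K)"
proof (rule bilinear_closed_span[OF _ _ _ assms])
  fix A B assume "A \<in> relation_matrix X c ` K" "B \<in> relation_matrix X c ` K"
  then obtain k k' where "A = relation_matrix X c k" "B = relation_matrix X c k'" by blast
  then have "A * B = A \<or> A * B = 0"
    by (cases "k = k'") (auto simp: relation_matrix_def fun_eq_iff)
  with \<open>A \<in> _\<close> show "A * B \<in> span (relation_matrix X c ` K)"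
    by (auto intro: span_base span_zero)
qed (simp_all add: linear_iff fun_eq_iff distrib_left distrib_right)

text \<open>Evaluation at a pair of colour \<open>k\<close> is a linear functional with value 1 on
  the matrix of \<open>k\<close> and 0 on the others, which gives independence.\<close>

lemma dim_span_relation_matrices:
  fixes X :: "'a set" and c :: "'a \<Rightarrow> 'a \<Rightarrow> 'k"
  assumes "\<And>k. k \<in> K \<Longrightarrow> \<exists>x\<in>X. \<exists>y\<in>X. c x y = k"
  shows "dim (span (relation_matrix X c ` K)) = card K"
proof -
  have eval: "relation_matrix X c k' x y = (if k' = k then 1 else 0)"
    if "x \<in> X" "y \<in> X" "c x y = k" for k k' x y
    using that by (auto simp: relation_matrix_def)
  have inj: "inj_on (relation_matrix X c) K"
  proof (rule inj_onI)
    fix k k' assume "k \<in> K" "k' \<in> K" and eq: "relation_matrix X c k = relation_matrix X c k'"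
    from assms[OF \<open>k \<in> K\<close>] obtain x y where "x \<in> X" "y \<in> X" "c x y = k" by blast
    from eval[OF this, of k] eval[OF this, of k'] show "k = k'"
      unfolding eq by (simp split: if_splits)
  qed
  have "independent (relation_matrix X c ` K)"
    unfolding dependent_def
  proof safe
    fix k assume k: "k \<in> K"
      and span: "relation_matrix X c k \<in> span (relation_matrix X c ` K - {relation_matrix X c k})"
    from assms[OF k] obtain x y where xy: "x \<in> X" "y \<in> X" "c x y = k" by blast
    have "span (relation_matrix X c ` K - {relation_matrix X c k}) \<subseteq> {M. M x y = 0}"
    proof (rule span_minimal)
      show "relation_matrix X c ` K - {relation_matrix X c k} \<subseteq> {M. M x y = 0}"
        by (auto simp: eval[OF xy])
      show "Real_Vector_Spaces.subspace {M :: 'a matrix. M x y = 0}"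
        by (rule real_vector.subspaceI) auto
    qed
    with span show False by (auto simp: eval[OF xy])
  qed
  then show ?thesis
    by (simp add: dim_eq_card_independent card_image[OF inj])
qed

definition eq_matrix :: "'a set \<Rightarrow> ('a \<Rightarrow> 'b) \<Rightarrow> 'a matrix" where
  "eq_matrix X f = (\<lambda>x y. if x \<in> X \<and> y \<in> X \<and> f x = f y then 1 else 0)"

lemma all_ones_on_eq_matrix: "all_ones_on X = eq_matrix X (\<lambda>_. ())"
  by (auto simp: all_ones_on_def eq_matrix_def fun_eq_iff)

text \<open>Each class of \<open>g\<close> is a union of classes of \<open>f\<close>, so summing a
  column of the matrix of \<open>g\<close> over a class of \<open>f\<close> adds \<open>c\<close>
  equal entries. The second product is the transpose of the first.\<close>

lemma mmult_eq_matrix: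
  assumes "finite X" and coarser: "\<And>x y. x \<in> X \<Longrightarrow> y \<in> X \<Longrightarrow> f x = f y \<Longrightarrow> g x = g y"
    and card: "\<And>x. x \<in> X \<Longrightarrow> card {z \<in> X. f z = f x} = c"
  shows "mmult_on X (eq_matrix X f) (eq_matrix X g) = real c *\<^sub>R eq_matrix X g"
    and "mmult_on X (eq_matrix X g) (eq_matrix X f) = real c *\<^sub>R eq_matrix X g"
proof -
  have "mmult_on X (eq_matrix X f) (eq_matrix X g) x y = real c * eq_matrix X g x y" for x y
  proof (cases "x \<in> X")
    case True
    have "mmult_on X (eq_matrix X f) (eq_matrix X g) x y =
        (\<Sum>z\<in>X. if f z = f x then eq_matrix X g x y else 0)"
      unfolding mmult_on_def
    proof (rule sum.cong)
      fix z assume "z \<in> X"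
      with True coarser[of x z]
      show "eq_matrix X f x z * eq_matrix X g z y = (if f z = f x then eq_matrix X g x y else 0)"
        by (auto simp: eq_matrix_def)
    qed simp
    also have "\<dots> = real (card {z \<in> X. f z = f x}) * eq_matrix X g x y"
      using \<open>finite X\<close> by (simp add: sum.If_cases Int_def)
    finally show ?thesis using card[OF True] by simp
  qed (simp add: mmult_on_def eq_matrix_def)
  moreover have "mmult_on X (eq_matrix X g) (eq_matrix X f) x y =
      mmult_on X (eq_matrix X f) (eq_matrix X g) y x" for x y
    unfolding mmult_on_def by (rule sum.cong) (auto simp: eq_matrix_def)
  moreover have "eq_matrix X g y x = eq_matrix X g x y" for x y
    by (auto simp: eq_matrix_def)
  ultimately show "mmult_on X (eq_matrix X f) (eq_matrix X g) = real c *\<^sub>R eq_matrix X g"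
    and "mmult_on X (eq_matrix X g) (eq_matrix X f) = real c *\<^sub>R eq_matrix X g"
    by (simp_all add: fun_eq_iff)
qed


section \<open>Hadamard matrices and appropriate Latin squares\<close>

text \<open>The number \<open>m\<close> of squares is left free: the algebra and its eigenvalues are
  found for every \<open>m \<ge> 2\<close>, and \<open>m = n - 3\<close> first enters with
  \<open>Adj_square\<close>.\<close>

locale hadamard_mals =
  fixes n m :: nat and H :: "real mat" and L :: "nat \<Rightarrow> nat \<Rightarrow> nat \<Rightarrow> nat"
  assumes n_ge_2: "n \<ge> 2" and m_ge_2: "m \<ge> 2"
    and hadamard: "hadamard_matrix n H"
    and first_row: "row H 0 = vec n (\<lambda>_. 1)"
    and mals: "MALS n m L"
begin

abbreviation "X \<equiv> Omega n m"

section \<open>Orthogonality in the Hadamard matrix\<close>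

definition h :: "nat \<Rightarrow> nat \<Rightarrow> real" where
  "h a x = row H (a - 1) $ (x - 1)"

lemma h_entry: "a \<in> {1..n} \<Longrightarrow> x \<in> {1..n} \<Longrightarrow> h a x = H $$ (a - 1, x - 1)"
  using hadamard by (auto simp: h_def hadamard_matrix_def)

lemma h_range:
  assumes "a \<in> {1..n}" "x \<in> {1..n}"
  shows "h a x = 1 \<or> h a x = -1"
proof -
  have "a - 1 < n" "x - 1 < n" using assms by auto
  then show ?thesis
    using hadamard by (auto simp: h_entry[OF assms] hadamard_matrix_def)
qed

lemma h_1: "x \<in> {1..n} \<Longrightarrow> h 1 x = 1"
  by (auto simp: h_def first_row)

lemma bij_betw_pred: "bij_betw (\<lambda>x. x - 1) {1..n} {..<n}"
  by (rule bij_betw_byWitness[where f' = Suc]) auto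

lemma h_rows_orthogonal:
  assumes "a \<in> {1..n}" "b \<in> {1..n}"
  shows "(\<Sum>x\<in>{1..n}. h a x * h b x) = (if a = b then real n else 0)"
proof -
  have dims: "H \<in> carrier_mat n n" and HHT: "H * transpose_mat H = of_nat n \<cdot>\<^sub>m 1\<^sub>m n"
    using hadamard by (auto simp: hadamard_matrix_def)
  have lt: "a - 1 < n" "b - 1 < n" using assms by auto
  have "(\<Sum>x\<in>{1..n}. h a x * h b x) = (\<Sum>x\<in>{1..n}. H $$ (a - 1, x - 1) * H $$ (b - 1, x - 1))"
    using assms by (simp add: h_entry)
  also have "\<dots> = (\<Sum>y<n. H $$ (a - 1, y) * H $$ (b - 1, y))"
    by (rule sum.reindex_bij_betw[OF bij_betw_pred])
  also have "\<dots> = (H * transpose_mat H) $$ (a - 1, b - 1)"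
    using dims lt by (simp add: scalar_prod_def atLeast0LessThan)
  also have "\<dots> = (if a = b then real n else 0)"
    using lt assms by (auto simp: HHT)
  finally show ?thesis .
qed

text \<open>By row orthogonality \<open>transpose_mat H\<close> divided by \<open>n\<close> is a
  right inverse of \<open>H\<close>; for square matrices it is also a left inverse.\<close>

lemma h_columns_orthogonal:
  assumes "x \<in> {1..n}" "y \<in> {1..n}"
  shows "(\<Sum>a\<in>{1..n}. h a x * h a y) = (if x = y then real n else 0)"
proof -
  have dims: "H \<in> carrier_mat n n" and HHT: "H * transpose_mat H = of_nat n \<cdot>\<^sub>m 1\<^sub>m n"
    using hadamard by (auto simp: hadamard_matrix_def)
  let ?K = "(1 / real n) \<cdot>\<^sub>m transpose_mat H"
  have K: "?K \<in> carrier_mat n n" using dims by simp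
  have "H * ?K = (1 / real n) \<cdot>\<^sub>m (H * transpose_mat H)"
    using dims by (intro mult_smult_distrib) auto
  also have "\<dots> = 1\<^sub>m n"
    unfolding HHT using n_ge_2 by (intro eq_matI) auto
  finally have "?K * H = 1\<^sub>m n"
    by (rule mat_mult_left_right_inverse[OF dims K])
  then have "(1 / real n) \<cdot>\<^sub>m (transpose_mat H * H) = 1\<^sub>m n"
    using dims mult_smult_assoc_mat[of "transpose_mat H" n n H n "1 / real n"] by simp
  moreover have lt: "x - 1 < n" "y - 1 < n" using assms by auto
  ultimately have "(1 / real n) * (transpose_mat H * H) $$ (x - 1, y - 1) = 1\<^sub>m n $$ (x - 1, y - 1)"
    using dims by (metis carrier_matD(2) index_mult_mat(2,3) index_smult_mat(1) index_transpose_mat(2))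
  moreover have "\<dots> = (if x = y then 1 else 0)"
    using lt assms by auto
  moreover have "(transpose_mat H * H) $$ (x - 1, y - 1) = (\<Sum>b<n. H $$ (b, x - 1) * H $$ (b, y - 1))"
    using dims lt by (simp add: scalar_prod_def atLeast0LessThan)
  moreover have "\<dots> = (\<Sum>a\<in>{1..n}. H $$ (a - 1, x - 1) * H $$ (a - 1, y - 1))"
    by (rule sum.reindex_bij_betw[OF bij_betw_pred, symmetric])
  moreover have "\<dots> = (\<Sum>a\<in>{1..n}. h a x * h a y)"
    using assms by (simp add: h_entry)
  ultimately show ?thesis using n_ge_2 by (auto simp: field_simps split: if_splits)
qed

text \<open>Row 1 is all ones, so omitting it, as symbols start at 2, costs exactly 1.\<close>

lemma sum_h_symbols:
  assumes "x \<in> {1..n}" "y \<in> {1..n}"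
  shows "(\<Sum>a\<in>{2..n}. h a x * h a y) = (if x = y then real n else 0) - 1"
proof -
  have "{1..n} = insert 1 {2..n}" using n_ge_2 by auto
  then show ?thesis
    using h_columns_orthogonal[OF assms] h_1[OF assms(1)] h_1[OF assms(2)] by simp
qed

lemma sum_h_row:
  assumes "a \<in> {2..n}"
  shows "(\<Sum>x\<in>{1..n}. h a x) = 0"
proof -
  have "(\<Sum>x\<in>{1..n}. h a x) = (\<Sum>x\<in>{1..n}. h a x * h 1 x)"
    by (rule sum.cong) (simp_all only: h_1 mult_1_right)
  also have "\<dots> = 0"
    using assms by (subst h_rows_orthogonal) auto
  finally show ?thesis .
qed

text \<open>Each row of a Latin square is a bijection from columns to symbols, and
  \<open>col i r\<close> is its inverse. It turns agreement of two rows into an equality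
  \<open>col i r a = col j s a\<close>.\<close>

definition col :: "nat \<Rightarrow> nat \<Rightarrow> nat \<Rightarrow> nat" where
  "col i r a = (THE c. c \<in> {1..n - 1} \<and> L i r c = a)"

lemma latin: "i \<in> {1..m} \<Longrightarrow> latin_square (n - 1) {1..n - 1} {1..n - 1} {2..n} (L i)"
  using mals by (auto simp: MALS_def)

lemma col_ex1:
  assumes "i \<in> {1..m}" "r \<in> {1..n - 1}" "a \<in> {2..n}"
  shows "\<exists>!c. c \<in> {1..n - 1} \<and> L i r c = a"
  using latin[OF assms(1)] assms(2,3) unfolding latin_square_def by blast

lemma col_props:
  assumes "i \<in> {1..m}" "r \<in> {1..n - 1}" "a \<in> {2..n}"
  shows "col i r a \<in> {1..n - 1}" "L i r (col i r a) = a"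
  using theI'[OF col_ex1[OF assms]] by (auto simp: col_def)

lemma col_eqI:
  assumes "i \<in> {1..m}" "r \<in> {1..n - 1}" "a \<in> {2..n}" "c \<in> {1..n - 1}" "L i r c = a"
  shows "col i r a = c"
  unfolding col_def using the1_equality[OF col_ex1[OF assms(1-3)]] assms(4,5) by blast

text \<open>Each symbol occurs once in each column. Hence, for fixed \<open>a\<close>, the pairs
  \<open>(i, r)\<close> with a given value of \<open>col\<close> meet every square in exactly one
  row.\<close>

lemma row_ex1:
  assumes "i \<in> {1..m}" "c \<in> {1..n - 1}" "a \<in> {2..n}"
  shows "\<exists>!r. r \<in> {1..n - 1} \<and> col i r a = c"
proof -
  have "\<exists>!r. r \<in> {1..n - 1} \<and> L i r c = a"
    using latin[OF assms(1)] assms(2,3) unfolding latin_square_def by blast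
  moreover have "col i r a = c \<longleftrightarrow> L i r c = a" if "r \<in> {1..n - 1}" for r
    using col_props[OF assms(1) that assms(3)] col_eqI[OF assms(1) that assms(3,2)] by auto
  ultimately show ?thesis by metis
qed

text \<open>If \<open>a\<close> stands in the same column of both rows, the rows agree there, and
  appropriateness leaves only one such column.\<close>

lemma col_eq_iff_common_symbol:
  assumes "i \<in> {1..m}" "j \<in> {1..m}" "i \<noteq> j" "r \<in> {1..n - 1}" "s \<in> {1..n - 1}" "a \<in> {2..n}"
  shows "col i r a = col j s a \<longleftrightarrow> a = common_symbol n L i j r s"
proof -
  have "appropriate {1..n - 1} {1..n - 1} (L i) (L j)"
    using mals assms by (auto simp: MALS_def)
  then have ex1: "\<exists>!c. c \<in> {1..n - 1} \<and> L i r c = L j s c"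
    using assms unfolding appropriate_def by blast
  define c where "c = (THE c. c \<in> {1..n - 1} \<and> L i r c = L j s c)"
  have c: "c \<in> {1..n - 1}" "L i r c = L j s c"
    using theI'[OF ex1] by (auto simp: c_def)
  have sym: "common_symbol n L i j r s = L i r c"
    by (simp add: common_symbol_def c_def)
  show ?thesis
  proof
    assume eq: "col i r a = col j s a"
    have "col i r a \<in> {1..n - 1} \<and> L i r (col i r a) = L j s (col i r a)"
      using col_props[OF assms(1,4,6)] col_props[OF assms(2,5,6)] by (simp add: eq)
    then have "c = col i r a"
      using ex1 c by blast
    then show "a = common_symbol n L i j r s"
      using col_props[OF assms(1,4,6)] by (simp add: sym)
  next
    assume "a = common_symbol n L i j r s"
    then show "col i r a = col j s a"
      using c col_eqI[OF assms(1,4,6) c(1)] col_eqI[OF assms(2,5,6) c(1)] by (simp add: sym)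
  qed
qed

lemma common_symbol_sym:
  assumes "i \<in> {1..m}" "j \<in> {1..m}" "i \<noteq> j" "r \<in> {1..n - 1}" "s \<in> {1..n - 1}"
  shows "common_symbol n L i j r s = common_symbol n L j i s r"
proof -
  have a: "common_symbol n L i j r s \<in> {2..n}"
    using common_symbol_range[OF mals assms] .
  have "col i r (common_symbol n L i j r s) = col j s (common_symbol n L i j r s)"
    using col_eq_iff_common_symbol[OF assms a] by simp
  then show ?thesis
    using col_eq_iff_common_symbol[of j i s r, OF _ _ _ _ _ a] assms by auto
qed

definition K :: "nat \<Rightarrow> nat \<times> nat \<Rightarrow> nat \<times> nat \<Rightarrow> real" where
  "K a = (\<lambda>(i, r) (j, s). if i \<noteq> j \<and> col i r a = col j s a then 1 else 0)"

text \<open>For a fixed symbol \<open>a\<close> the pairs \<open>(i, r)\<close> with equal \<open>col i r a\<close> form a clique of order \<open>m\<close>,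
  and \<open>K a\<close> is the adjacency matrix of the disjoint union of these \<open>n - 1\<close> cliques.\<close>

lemma K_square:
  assumes "i \<in> {1..m}" "j \<in> {1..m}" "r \<in> {1..n - 1}" "s \<in> {1..n - 1}" "a \<in> {2..n}"
  shows "(\<Sum>k\<in>{1..m}. \<Sum>q\<in>{1..n - 1}. K a (i, r) (k, q) * K a (k, q) (j, s)) =
    (if i = j then if r = s then real m - 1 else 0 else (real m - 2) * K a (i, r) (j, s))"
proof -
  let ?P = "col i r a = col j s a"
  \<comment> \<open>In square \<open>k\<close> exactly one row \<open>q0\<close> has
    \<open>a\<close> in the column \<open>col i r a\<close>, so the sum over \<open>q\<close> has at
    most one non-zero term.\<close>
  have inner: "(\<Sum>q\<in>{1..n - 1}. K a (i, r) (k, q) * K a (k, q) (j, s)) =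
      (if k \<in> {1..m} - {i, j} then (if ?P then 1 else 0) else 0)" if "k \<in> {1..m}" for k
  proof -
    from row_ex1[OF that col_props(1)[OF assms(1,3,5)] assms(5)]
    obtain q0 where q0: "q0 \<in> {1..n - 1}" "\<And>q. q \<in> {1..n - 1} \<Longrightarrow> col k q a = col i r a \<longleftrightarrow> q = q0"
      by metis
    have "(\<Sum>q\<in>{1..n - 1}. K a (i, r) (k, q) * K a (k, q) (j, s)) =
        (\<Sum>q\<in>{1..n - 1}. if q = q0 then (if k \<noteq> i \<and> k \<noteq> j \<and> ?P then 1 else 0) else 0)"
    proof (rule sum.cong)
      fix q assume "q \<in> {1..n - 1}"
      from q0(2)[OF this] show "K a (i, r) (k, q) * K a (k, q) (j, s) =
          (if q = q0 then (if k \<noteq> i \<and> k \<noteq> j \<and> ?P then 1 else 0) else 0)"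
        by (auto simp: K_def)
    qed simp
    also have "\<dots> = (if k \<in> {1..m} - {i, j} then (if ?P then 1 else 0) else 0)"
      using q0(1) that by simp
    finally show ?thesis .
  qed
  have "(\<Sum>k\<in>{1..m}. \<Sum>q\<in>{1..n - 1}. K a (i, r) (k, q) * K a (k, q) (j, s)) =
      (\<Sum>k\<in>{1..m}. if k \<in> {1..m} - {i, j} then (if ?P then 1 else 0) else 0)"
    by (rule sum.cong[OF refl inner])
  also have "\<dots> = (\<Sum>k\<in>{1..m} - {i, j}. if ?P then 1 else 0)"
    by (rule sum.mono_neutral_cong_right) auto
  \<comment> \<open>The intermediate square must differ from both ends, which leaves
    \<open>m - 1\<close> choices for \<open>i = j\<close> and \<open>m - 2\<close>
    otherwise.\<close>
  also have "\<dots> = real (m - card {i, j}) * (if ?P then 1 else 0)"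
    using assms by (simp add: card_Diff_subset)
  also have "\<dots> = (if i = j then if r = s then real m - 1 else 0 else (real m - 2) * K a (i, r) (j, s))"
  proof (cases "i = j")
    case True
    have "?P \<longleftrightarrow> r = s"
      using row_ex1[OF assms(1) col_props(1)[OF assms(1,3,5)] assms(5)] assms(3,4) True by metis
    with True m_ge_2 show ?thesis by simp
  next
    case False
    with m_ge_2 show ?thesis by (auto simp: K_def)
  qed
  finally show ?thesis .
qed

section \<open>The signed matrix \<open>N\<close> and its square\<close>

definition N :: "(nat \<times> nat \<times> nat) matrix" where
  "N = (\<lambda>(i, r, x) (j, s, y). if (i, r, x) \<in> X \<and> (j, s, y) \<in> X \<and> i \<noteq> j
     then h (common_symbol n L i j r s) x * h (common_symbol n L i j r s) y else 0)"

lemma finite_X [simp]: "finite X"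
  by (simp add: Omega_def)

lemma sum_X: "(\<Sum>w\<in>X. f w) = (\<Sum>k\<in>{1..m}. \<Sum>q\<in>{1..n - 1}. \<Sum>z\<in>{1..n}. f (k, q, z))"
  by (simp add: Omega_def sum.cartesian_product)

text \<open>For \<open>i \<noteq> j\<close> exactly one symbol, the common one, contributes. Thus
  \<open>N\<close> is the sum over \<open>a\<close> of \<open>K a\<close> tensored with the rank-one
  matrix of \<open>h a\<close>.\<close>

lemma N_eq_sum:
  assumes "(i, r, x) \<in> X" "(j, s, y) \<in> X"
  shows "N (i, r, x) (j, s, y) = (\<Sum>a\<in>{2..n}. K a (i, r) (j, s) * (h a x * h a y))"
proof (cases "i = j")
  case True
  then show ?thesis by (simp add: N_def K_def)
next
  case False
  let ?l = "common_symbol n L i j r s"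
  have mem: "i \<in> {1..m}" "j \<in> {1..m}" "r \<in> {1..n - 1}" "s \<in> {1..n - 1}"
    using assms by (auto simp: Omega_def)
  have "(\<Sum>a\<in>{2..n}. K a (i, r) (j, s) * (h a x * h a y)) =
      (\<Sum>a\<in>{2..n}. if a = ?l then h ?l x * h ?l y else 0)"
    using col_eq_iff_common_symbol[OF mem(1,2) False mem(3,4)] False
    by (intro sum.cong) (auto simp: K_def)
  then show ?thesis
    using assms False common_symbol_range[OF mals mem(1,2) False mem(3,4)] by (simp add: N_def)
qed

lemma N_sym: "N u v = N v u"
proof (cases u; cases v)
  fix i r x j s y assume uv: "u = (i, r, x)" "v = (j, s, y)"
  show ?thesis
  proof (cases "u \<in> X \<and> v \<in> X \<and> i \<noteq> j")
    case True
    then have "common_symbol n L i j r s = common_symbol n L j i s r"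
      unfolding uv by (intro common_symbol_sym) (auto simp: Omega_def)
    with True uv show ?thesis by (simp add: N_def)
  qed (auto simp: N_def uv)
qed

text \<open>Inside a block \<open>(k, q)\<close> the weight is constant and the row of
  \<open>N\<close> is zero or a multiple of some \<open>h a\<close> with \<open>a \<ge> 2\<close>,
  whose entries sum to zero.\<close>

lemma N_row_sum:
  assumes "u \<in> X"
  shows "(\<Sum>w\<in>X. N u w * (case w of (k, q, z) \<Rightarrow> g k q)) = 0"
proof -
  obtain i r x where u: "u = (i, r, x)" by (cases u)
  have "(\<Sum>z\<in>{1..n}. N u (k, q, z) * g k q) = 0" if "k \<in> {1..m}" "q \<in> {1..n - 1}" for k q
  proof (cases "i = k")
    case False
    let ?l = "common_symbol n L i k r q"
    have l: "?l \<in> {2..n}"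
      using assms that False by (intro common_symbol_range[OF mals]) (auto simp: u Omega_def)
    have "(\<Sum>z\<in>{1..n}. N u (k, q, z) * g k q) = (\<Sum>z\<in>{1..n}. h ?l x * g k q * h ?l z)"
      using assms that False by (intro sum.cong) (auto simp: u N_def Omega_def)
    then show ?thesis
      by (simp add: sum_h_row[OF l] del: One_nat_def flip: sum_distrib_left)
  qed (simp add: N_def u)
  then show ?thesis by (simp add: sum_X)
qed

text \<open>When the sum over symbols is squared, row orthogonality kills all terms with two
  different symbols. What remains is \<open>n\<close> times the sum of \<open>K a\<close> squared
  tensored with the rank-one matrices. \<open>K_square\<close> then yields either \<open>N\<close>
  again or, for \<open>(i, r) = (j, s)\<close>, the sum evaluated in
  \<open>sum_h_symbols\<close>.\<close>

lemma N_square_entry: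
  assumes "(i, r, x) \<in> X" "(j, s, y) \<in> X"
  shows "mmult_on X N N (i, r, x) (j, s, y) =
    (if i = j then if r = s then n * (real m - 1) * ((if x = y then real n else 0) - 1) else 0
     else n * (real m - 2) * N (i, r, x) (j, s, y))"
proof -
  have mem: "i \<in> {1..m}" "j \<in> {1..m}" "r \<in> {1..n - 1}" "s \<in> {1..n - 1}" "x \<in> {1..n}" "y \<in> {1..n}"
    using assms by (auto simp: Omega_def)
  have z_sum: "(\<Sum>z\<in>{1..n}. N (i, r, x) (k, q, z) * N (k, q, z) (j, s, y)) =
      (\<Sum>a\<in>{2..n}. n * (h a x * h a y) * (K a (i, r) (k, q) * K a (k, q) (j, s)))"
    if kq: "k \<in> {1..m}" "q \<in> {1..n - 1}" for k q
  proof -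
    have "(\<Sum>z\<in>{1..n}. N (i, r, x) (k, q, z) * N (k, q, z) (j, s, y)) =
        (\<Sum>z\<in>{1..n}. \<Sum>a\<in>{2..n}. \<Sum>b\<in>{2..n}.
          K a (i, r) (k, q) * K b (k, q) (j, s) * (h a x * h b y) * (h a z * h b z))"
    proof (rule sum.cong)
      fix z assume "z \<in> {1..n}"
      then have "(k, q, z) \<in> X" using kq by (auto simp: Omega_def)
      then show "N (i, r, x) (k, q, z) * N (k, q, z) (j, s, y) = (\<Sum>a\<in>{2..n}. \<Sum>b\<in>{2..n}.
          K a (i, r) (k, q) * K b (k, q) (j, s) * (h a x * h b y) * (h a z * h b z))"
        using assms by (simp add: N_eq_sum sum_product mult_ac)
    qed simp
    also have "\<dots> = (\<Sum>a\<in>{2..n}. \<Sum>b\<in>{2..n}.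
        K a (i, r) (k, q) * K b (k, q) (j, s) * (h a x * h b y) * (\<Sum>z\<in>{1..n}. h a z * h b z))"
      by (subst sum.swap, rule sum.cong[OF refl], subst sum.swap) (simp add: sum_distrib_left)
    also have "\<dots> = (\<Sum>a\<in>{2..n}. \<Sum>b\<in>{2..n}. if b = a then
        n * (h a x * h a y) * (K a (i, r) (k, q) * K a (k, q) (j, s)) else 0)"
      by (intro sum.cong) (auto simp: h_rows_orthogonal simp del: One_nat_def)
    also have "\<dots> = (\<Sum>a\<in>{2..n}. n * (h a x * h a y) * (K a (i, r) (k, q) * K a (k, q) (j, s)))"
      by (intro sum.cong) auto
    finally show ?thesis .
  qed
  have "mmult_on X N N (i, r, x) (j, s, y) =
      (\<Sum>k\<in>{1..m}. \<Sum>q\<in>{1..n - 1}. \<Sum>a\<in>{2..n}.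
        n * (h a x * h a y) * (K a (i, r) (k, q) * K a (k, q) (j, s)))"
    unfolding mmult_on_def sum_X by (intro sum.cong refl z_sum)
  also have "\<dots> = (\<Sum>a\<in>{2..n}. n * (h a x * h a y) *
      (\<Sum>k\<in>{1..m}. \<Sum>q\<in>{1..n - 1}. K a (i, r) (k, q) * K a (k, q) (j, s)))"
    unfolding sum_distrib_left
    by (rule trans[OF sum.cong[OF refl sum.swap] sum.swap])
  also have "\<dots> = (\<Sum>a\<in>{2..n}. n * (h a x * h a y) *
      (if i = j then if r = s then real m - 1 else 0 else (real m - 2) * K a (i, r) (j, s)))"
    by (rule sum.cong) (simp_all only: K_square[OF mem(1-4)])
  also have "\<dots> = (if i = j then if r = s then n * (real m - 1) * ((if x = y then real n else 0) - 1) else 0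
     else n * (real m - 2) * N (i, r, x) (j, s, y))"
    unfolding N_eq_sum[OF assms] sum_h_symbols[OF mem(5,6), symmetric] sum_distrib_left
    by (auto intro!: sum.cong simp: mult_ac)
  finally show ?thesis .
qed


section \<open>The coherent algebra\<close>

abbreviation "I \<equiv> identity_on X"
abbreviation "J \<equiv> all_ones_on X"
text \<open>\<open>C1\<close> and \<open>C2\<close> are \<open>I \<otimes> I \<otimes> J\<close> and \<open>I \<otimes> J \<otimes> J\<close>.\<close>

definition C1 :: "(nat \<times> nat \<times> nat) matrix" where
  "C1 = eq_matrix X (\<lambda>(i, r, x). (i, r))"
definition C2 :: "(nat \<times> nat \<times> nat) matrix" where
  "C2 = eq_matrix X fst"
definition Adj :: "(nat \<times> nat \<times> nat) matrix" where
  "Adj = adjacency_matrix (Gamma n m H L)"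

lemma entries:
  assumes "(i, r, x) \<in> X" "(j, s, y) \<in> X"
  shows "I (i, r, x) (j, s, y) = (if i = j \<and> r = s \<and> x = y then 1 else 0)"
    and "J (i, r, x) (j, s, y) = 1"
    and "C1 (i, r, x) (j, s, y) = (if i = j \<and> r = s then 1 else 0)"
    and "C2 (i, r, x) (j, s, y) = (if i = j then 1 else 0)"
  using assms by (auto simp: identity_on_def all_ones_on_def C1_def C2_def eq_matrix_def)

lemma in_matrices_on: "I \<in> matrices_on X" "J \<in> matrices_on X" "C1 \<in> matrices_on X" "C2 \<in> matrices_on X"
  "N \<in> matrices_on X"
  by (auto simp: matrices_on_def identity_on_def all_ones_on_def C1_def C2_def eq_matrix_def N_def)

lemma outside: "u \<notin> X \<or> v \<notin> X \<Longrightarrow> I u v = 0 \<and> J u v = 0 \<and> C1 u v = 0 \<and> C2 u v = 0 \<and> N u v = 0"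
  using in_matrices_on unfolding matrices_on_def by blast

lemma matrix_eqI:
  assumes "\<And>i r x j s y. (i, r, x) \<in> X \<Longrightarrow> (j, s, y) \<in> X \<Longrightarrow> A (i, r, x) (j, s, y) = B (i, r, x) (j, s, y)"
    and "\<And>u v. u \<notin> X \<or> v \<notin> X \<Longrightarrow> A u v = B u v"
  shows "A = B"
proof (intro ext)
  fix u v show "A u v = B u v"
    using assms by (cases u; cases v) blast
qed

lemma N_diagonal_block: "N (i, r, x) (i, s, y) = 0"
  by (simp add: N_def)

lemma N_square:
  "mmult_on X N N = (n * (real m - 2)) *\<^sub>R N + (n * (real m - 1)) *\<^sub>R (real n *\<^sub>R I - C1)"
proof (rule matrix_eqI)
  fix u v assume uv: "u \<notin> X \<or> v \<notin> X"
  have "mmult_on X N N u v = 0"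
    unfolding mmult_on_def using uv outside[of u] outside[of _ v] by (intro sum.neutral) auto
  then show "mmult_on X N N u v =
      ((n * (real m - 2)) *\<^sub>R N + (n * (real m - 1)) *\<^sub>R (real n *\<^sub>R I - C1)) u v"
    by (simp add: outside[OF uv])
qed (auto simp: N_square_entry entries N_diagonal_block)

lemma Adj_eq: "Adj = (1 / 2) *\<^sub>R (J + C2 + N) - C1"
proof (rule matrix_eqI)
  fix u v assume "u \<notin> X \<or> v \<notin> X"
  then show "Adj u v = ((1 / 2) *\<^sub>R (J + C2 + N) - C1) u v"
    using outside[of u v] by (auto simp: Adj_def adjacency_matrix_def Gamma_def)
next
  fix i r x j s y assume X: "(i, r, x) \<in> X" "(j, s, y) \<in> X"
  then have "Adj (i, r, x) (j, s, y) = A2 n m H L (i, r, x) (j, s, y) + A4 n m (i, r, x) (j, s, y)"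
    by (simp add: Adj_def adjacency_matrix_Gamma[OF hadamard mals])
  with X show "Adj (i, r, x) (j, s, y) = ((1 / 2) *\<^sub>R (J + C2 + N) - C1) (i, r, x) (j, s, y)"
    by (auto simp: entries A2_def A4_def N_def rank_one_matrix_def h_def)
qed

lemma symmetric: "I u v = I v u" "J u v = J v u" "C1 u v = C1 v u" "C2 u v = C2 v u" "Adj u v = Adj v u"
  using N_sym[of u v]
  by (auto simp: Adj_eq C1_def C2_def eq_matrix_def identity_on_def all_ones_on_def)

section \<open>Block sizes and the multiplication table\<close>

lemma card_X: "card X = m * ((n - 1) * n)"
  by (simp add: Omega_def)

lemma card_blocks:
  assumes "u \<in> X"
  shows "card {w \<in> X. (case w of (i, r, x) \<Rightarrow> (i, r)) = (case u of (i, r, x) \<Rightarrow> (i, r))} = n"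
    and "card {w \<in> X. fst w = fst u} = (n - 1) * n"
proof -
  obtain i r x where u: "u = (i, r, x)" by (cases u)
  have "{w \<in> X. (case w of (i, r, x) \<Rightarrow> (i, r)) = (case u of (i, r, x) \<Rightarrow> (i, r))} = {i} \<times> {r} \<times> {1..n}"
    using assms by (auto simp: u Omega_def)
  then show "card {w \<in> X. (case w of (i, r, x) \<Rightarrow> (i, r)) = (case u of (i, r, x) \<Rightarrow> (i, r))} = n"
    by (simp add: card_cartesian_product)
  have "{w \<in> X. fst w = fst u} = {i} \<times> {1..n - 1} \<times> {1..n}"
    using assms by (auto simp: u Omega_def)
  then show "card {w \<in> X. fst w = fst u} = (n - 1) * n"
    by (simp add: card_cartesian_product)
qed

lemma C1_mult_eq_matrix:
  assumes "\<And>k q z. f (k, q, z) = F k q"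
  shows "mmult_on X C1 (eq_matrix X f) = real n *\<^sub>R eq_matrix X f"
    and "mmult_on X (eq_matrix X f) C1 = real n *\<^sub>R eq_matrix X f"
proof -
  have coarser: "f u = f v" if "(case u of (i, r, x) \<Rightarrow> (i, r)) = (case v of (i, r, x) \<Rightarrow> (i, r))" for u v
    using that by (cases u; cases v) (simp add: assms)
  show "mmult_on X C1 (eq_matrix X f) = real n *\<^sub>R eq_matrix X f"
    "mmult_on X (eq_matrix X f) C1 = real n *\<^sub>R eq_matrix X f"
    unfolding C1_def by (rule mmult_eq_matrix[OF finite_X coarser card_blocks(1)]; assumption)+
qed

lemma C2_mult_eq_matrix:
  assumes "\<And>u. f u = F (fst u)"
  shows "mmult_on X C2 (eq_matrix X f) = ((real n - 1) * real n) *\<^sub>R eq_matrix X f"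
    and "mmult_on X (eq_matrix X f) C2 = ((real n - 1) * real n) *\<^sub>R eq_matrix X f"
proof -
  have t: "real ((n - 1) * n) = (real n - 1) * real n"
    using n_ge_2 by (simp add: of_nat_diff)
  have coarser: "f u = f v" if "fst u = fst v" for u v
    using that by (simp add: assms)
  show "mmult_on X C2 (eq_matrix X f) = ((real n - 1) * real n) *\<^sub>R eq_matrix X f"
    "mmult_on X (eq_matrix X f) C2 = ((real n - 1) * real n) *\<^sub>R eq_matrix X f"
    unfolding C2_def t[symmetric]
    by (rule mmult_eq_matrix[OF finite_X coarser card_blocks(2)]; assumption)+
qed

text \<open>The three partitions are nested: a product of two of their matrices is the coarser one
  times the class size of the finer one.\<close>

lemma block_products:
  "mmult_on X C1 C1 = real n *\<^sub>R C1"
  "mmult_on X C1 C2 = real n *\<^sub>R C2" "mmult_on X C2 C1 = real n *\<^sub>R C2"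
  "mmult_on X C1 J = real n *\<^sub>R J" "mmult_on X J C1 = real n *\<^sub>R J"
  "mmult_on X C2 C2 = ((real n - 1) * real n) *\<^sub>R C2"
  "mmult_on X C2 J = ((real n - 1) * real n) *\<^sub>R J" "mmult_on X J C2 = ((real n - 1) * real n) *\<^sub>R J"
  "mmult_on X J J = (real m * ((real n - 1) * real n)) *\<^sub>R J"
proof -
  show "mmult_on X C1 C1 = real n *\<^sub>R C1"
    by (subst (2) C1_def, subst C1_mult_eq_matrix) (simp_all add: C1_def)
  show "mmult_on X C1 C2 = real n *\<^sub>R C2" "mmult_on X C2 C1 = real n *\<^sub>R C2"
    unfolding C2_def by (rule C1_mult_eq_matrix, simp)+
  show "mmult_on X C1 J = real n *\<^sub>R J" "mmult_on X J C1 = real n *\<^sub>R J"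
    unfolding all_ones_on_eq_matrix by (rule C1_mult_eq_matrix, simp)+
  show "mmult_on X C2 C2 = ((real n - 1) * real n) *\<^sub>R C2"
    by (subst (2) C2_def, subst C2_mult_eq_matrix) (simp_all add: C2_def)
  show "mmult_on X C2 J = ((real n - 1) * real n) *\<^sub>R J" "mmult_on X J C2 = ((real n - 1) * real n) *\<^sub>R J"
    unfolding all_ones_on_eq_matrix by (rule C2_mult_eq_matrix, simp)+
  have "real (card X) = real m * ((real n - 1) * real n)"
    using n_ge_2 by (simp add: card_X of_nat_diff)
  then show "mmult_on X J J = (real m * ((real n - 1) * real n)) *\<^sub>R J"
    by (auto simp: fun_eq_iff mmult_on_def all_ones_on_def)
qed

lemma N_mult_eq_matrix:
  assumes "\<And>k q z. f (k, q, z) = F k q"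
  shows "mmult_on X N (eq_matrix X f) = 0" and "mmult_on X (eq_matrix X f) N = 0"
proof -
  have "mmult_on X N (eq_matrix X f) u v = 0" for u v
  proof (cases "u \<in> X")
    case True
    have "mmult_on X N (eq_matrix X f) u v = (\<Sum>w\<in>X. N u w *
        (case w of (k, q, z) \<Rightarrow> if v \<in> X \<and> F k q = f v then 1 else 0))"
      unfolding mmult_on_def by (rule sum.cong) (auto simp: eq_matrix_def assms)
    then show ?thesis by (simp add: N_row_sum[OF True])
  qed (simp add: mmult_on_def outside)
  moreover have "mmult_on X (eq_matrix X f) N u v = mmult_on X N (eq_matrix X f) v u" for u v
    unfolding mmult_on_def using N_sym by (auto simp: eq_matrix_def intro!: sum.cong)
  ultimately show "mmult_on X N (eq_matrix X f) = 0" "mmult_on X (eq_matrix X f) N = 0"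
    by (simp_all add: fun_eq_iff)
qed

lemma N_products:
  "mmult_on X N C1 = 0" "mmult_on X N C2 = 0" "mmult_on X N J = 0"
  "mmult_on X C1 N = 0" "mmult_on X C2 N = 0" "mmult_on X J N = 0"
proof -
  show "mmult_on X N C1 = 0" "mmult_on X C1 N = 0"
    unfolding C1_def by (rule N_mult_eq_matrix, simp)+
  show "mmult_on X N C2 = 0" "mmult_on X C2 N = 0"
    unfolding C2_def by (rule N_mult_eq_matrix, simp)+
  show "mmult_on X N J = 0" "mmult_on X J N = 0"
    unfolding all_ones_on_eq_matrix by (rule N_mult_eq_matrix, simp)+
qed

text \<open>The factor of \<open>J\<close> in the first line is the valency:
  \<open>(m - 1) (n - 1) n / 2\<close> neighbours in other squares and \<open>(n - 2) n\<close> in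
  the same one. In the last line only half the square of \<open>N\<close> survives.\<close>

lemma Adj_products:
  "mmult_on X J Adj = (((real m + 1) * (real n - 1) / 2 - 1) * n) *\<^sub>R J"
  "mmult_on X C1 Adj = (real n / 2) *\<^sub>R J + (real n / 2) *\<^sub>R C2 - real n *\<^sub>R C1"
  "mmult_on X C2 Adj = (real n * (real n - 1) / 2) *\<^sub>R J + (real n * (real n - 3) / 2) *\<^sub>R C2"
  "mmult_on X N Adj = (n * (real m - 2) / 2) *\<^sub>R N + (n * (real m - 1) / 2) *\<^sub>R (real n *\<^sub>R I - C1)"
  by (simp_all add: Adj_eq mmult_on_linear block_products N_products N_square)
    (simp_all add: fun_eq_iff field_simps)

lemma Adj_in_matrices_on: "Adj \<in> matrices_on X"
  by (auto simp: matrices_on_def Adj_eq outside)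

text \<open>For general \<open>m\<close>, the square of \<open>Adj\<close> contains
  \<open>C2\<close> with coefficient \<open>n (n - 5) / 4\<close> and \<open>N\<close> with
  \<open>n (m - 2) / 4\<close>. These coincide exactly for \<open>m = n - 3\<close>; then both are
  absorbed into a multiple of \<open>Adj\<close>, and only \<open>J\<close>, \<open>C1\<close> and
  \<open>I\<close> remain. Thus arcs within a square and arcs between squares have equally many
  common neighbours.\<close>

lemma Adj_square:
  assumes m: "real m = real n - 3"
  shows "mmult_on X Adj Adj = (n * (real n - 1) * (real n - 2) / 4) *\<^sub>R J +
    (n * (real n - 5) / 2) *\<^sub>R Adj + (n * (real n - 2) / 4) *\<^sub>R C1 + (real n ^ 2 * (real n - 4) / 4) *\<^sub>R I"
proof -
  have "mmult_on X Adj Adj = mmult_on X ((1 / 2) *\<^sub>R (J + C2 + N) - C1) Adj"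
    by (simp add: Adj_eq)
  also have "\<dots> = (1 / 2) *\<^sub>R (mmult_on X J Adj + mmult_on X C2 Adj + mmult_on X N Adj) - mmult_on X C1 Adj"
    by (simp add: mmult_on_linear)
  finally have square: "mmult_on X Adj Adj = \<dots>" .
  show ?thesis
    unfolding square Adj_products by (simp add: Adj_eq m fun_eq_iff field_simps power2_eq_square)
qed

text \<open>Numbered such that \<open>relation_matrix X relation k\<close> is the paper's \<open>A\<^sub>k\<close> for \<open>k = 2\<close> and \<open>k = 4\<close>.\<close>

definition relation :: "nat \<times> nat \<times> nat \<Rightarrow> nat \<times> nat \<times> nat \<Rightarrow> nat" where
  "relation = (\<lambda>(i, r, x) (j, s, y).
     if i \<noteq> j then
       if h (common_symbol n L i j r s) x = h (common_symbol n L i j r s) y then 2 else 3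
     else if r \<noteq> s then 4 else if x \<noteq> y then 1 else 0)"

section \<open>Relation matrices, coherent closure and rank\<close>

abbreviation "R \<equiv> relation_matrix X relation"

text \<open>Between different squares the entries of \<open>N\<close> are 1 or -1, and 1 means that
  the two entries of the Hadamard row agree; so \<open>(J - C2 + N) / 2\<close> and
  \<open>(J - C2 - N) / 2\<close> are 0-1 matrices.\<close>

lemma relation_matrices:
  "R 0 = I" "R 1 = C1 - I" "R 2 = (1 / 2) *\<^sub>R (J - C2 + N)" "R 3 = (1 / 2) *\<^sub>R (J - C2 - N)" "R 4 = C2 - C1"
proof -
  have N: "N (i, r, x) (j, s, y) = (if i = j then 0 else
      if h (common_symbol n L i j r s) x = h (common_symbol n L i j r s) y then 1 else -1)"
    if X: "(i, r, x) \<in> X" "(j, s, y) \<in> X" for i r x j s y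
  proof (cases "i = j")
    case False
    let ?l = "common_symbol n L i j r s"
    have "?l \<in> {2..n}"
      using X False by (intro common_symbol_range[OF mals]) (auto simp: Omega_def)
    then have "?l \<in> {1..n}" "x \<in> {1..n}" "y \<in> {1..n}"
      using X by (auto simp: Omega_def)
    then have "h ?l x = 1 \<or> h ?l x = -1" "h ?l y = 1 \<or> h ?l y = -1"
      by (simp_all only: h_range)
    with X False show ?thesis by (auto simp: N_def)
  qed (simp add: N_def)
  have out: "R k u v = 0" if "u \<notin> X \<or> v \<notin> X" for k u v
    using that by (auto simp: relation_matrix_def)
  show "R 0 = I" "R 1 = C1 - I" "R 2 = (1 / 2) *\<^sub>R (J - C2 + N)" "R 3 = (1 / 2) *\<^sub>R (J - C2 - N)" "R 4 = C2 - C1"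
    by (rule matrix_eqI, simp add: relation_matrix_def entries N relation_def, simp add: out outside)+
qed

abbreviation "S \<equiv> {I, J, C1, C2, N}"

text \<open>Two generating sets of one space: with the relation matrices closure under entrywise
  products is evident, with \<open>S\<close> closure under matrix products.\<close>

lemma span_relation_matrices: "span (R ` {0, 1, 2, 3, 4}) = span S"
proof (rule subset_antisym)
  have base: "I \<in> span S" "J \<in> span S" "C1 \<in> span S" "C2 \<in> span S" "N \<in> span S"
    by (auto intro: span_base)
  show "span (R ` {0, 1, 2, 3, 4}) \<subseteq> span S"
    by (rule span_minimal)
      (auto simp: relation_matrices relation_matrices(2)[unfolded One_nat_def]
        intro!: base span_add span_diff span_scale)
  let ?T = "span (R ` {0, 1, 2, 3, 4})"
  have R: "R 0 \<in> ?T" "R 1 \<in> ?T" "R 2 \<in> ?T" "R 3 \<in> ?T" "R 4 \<in> ?T"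
    by (auto intro: span_base)
  have "I = R 0" "C1 = R 1 + R 0" "C2 = R 4 + (R 1 + R 0)" "N = R 2 - R 3" "J = R 2 + R 3 + (R 4 + (R 1 + R 0))"
    unfolding relation_matrices by (simp_all add: fun_eq_iff field_simps)
  then have "I \<in> ?T" "C1 \<in> ?T" "C2 \<in> ?T" "N \<in> ?T" "J \<in> ?T"
    using R by (metis span_add span_diff)+
  then show "span S \<subseteq> ?T"
    by (intro span_minimal) auto
qed

lemma coherent_algebra_span: "coherent_algebra X (span S)"
  unfolding coherent_algebra_def
proof (intro conjI ballI)
  have "Real_Vector_Spaces.subspace (matrices_on X)"
    using coherent_algebra_matrices_on[of X] by (simp add: coherent_algebra_def)
  then show "span S \<subseteq> matrices_on X"
    using in_matrices_on by (intro span_minimal) auto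
  show "Real_Vector_Spaces.subspace (span S)" by simp
  show "I \<in> span S" "J \<in> span S" by (auto intro: span_base)
next
  fix A assume "A \<in> span S"
  \<comment> \<open>All generators are symmetric, so transposition fixes the whole span.\<close>
  moreover have "span S \<subseteq> {A. (\<lambda>x y. A y x) = A}"
    by (rule span_minimal)
      (auto intro!: real_vector.subspaceI simp: fun_eq_iff symmetric N_sym intro: symmetric N_sym)
  ultimately show "(\<lambda>x y. A y x) \<in> span S" by auto
next
  fix A B assume AB: "A \<in> span S" "B \<in> span S"
  show "A * B \<in> span S"
    using AB span_relation_matrices_times_closed unfolding span_relation_matrices[symmetric] by blast
  have base: "I \<in> span S" "J \<in> span S" "C1 \<in> span S" "C2 \<in> span S" "N \<in> span S"
    by (auto intro: span_base)
  show "mmult_on X A B \<in> span S"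
  proof (rule bilinear_closed_span[OF _ _ _ AB])
    fix A B assume "A \<in> S" "B \<in> S"
    then show "mmult_on X A B \<in> span S"
      by (auto simp: block_products N_products N_square mmult_on_identity_left mmult_on_identity_right
          in_matrices_on intro!: base span_add span_diff span_scale span_zero)
  qed (simp_all add: linear_iff mmult_on_linear)
qed

lemma coherent_closure_eq:
  assumes m: "real m = real n - 3"
  shows "coherent_closure X Adj = span S"
proof (rule subset_antisym)
  have "Adj \<in> span S"
    unfolding Adj_eq by (intro span_add span_diff span_scale span_base) auto
  then show "coherent_closure X Adj \<subseteq> span S"
    by (rule coherent_closure_is_least(3)[OF Adj_in_matrices_on coherent_algebra_span])
  let ?A = "coherent_closure X Adj"
  note least = coherent_closure_is_least(1,2)[OF Adj_in_matrices_on]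
  have sub: "Real_Vector_Spaces.subspace ?A" and IJ: "I \<in> ?A" "J \<in> ?A"
    and mult: "\<And>A B. A \<in> ?A \<Longrightarrow> B \<in> ?A \<Longrightarrow> mmult_on X A B \<in> ?A"
    using least(1) by (auto simp: coherent_algebra_def)
  note closed = real_vector.subspace_add[OF sub] real_vector.subspace_diff[OF sub]
    real_vector.subspace_scale[OF sub]
  \<comment> \<open>From \<open>m = n - 3\<close> and \<open>m \<ge> 2\<close>; it keeps the
    divisors \<open>n (n - 2)\<close> and \<open>n\<close> below from vanishing.\<close>
  have n: "n \<ge> 5" using m m_ge_2 by linarith
  have "C1 = (4 / (n * (real n - 2))) *\<^sub>R (mmult_on X Adj Adj - (n * (real n - 1) * (real n - 2) / 4) *\<^sub>R J -
      (n * (real n - 5) / 2) *\<^sub>R Adj - (real n ^ 2 * (real n - 4) / 4) *\<^sub>R I)"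
    unfolding Adj_square[OF m] using n by (simp add: fun_eq_iff field_simps)
  also have "\<dots> \<in> ?A"
    by (intro closed mult least(2) IJ)
  finally have C1: "C1 \<in> ?A" .
  have "C2 = (2 / n) *\<^sub>R (mmult_on X C1 Adj + real n *\<^sub>R C1) - J"
    unfolding Adj_products using n by (simp add: fun_eq_iff field_simps)
  also have "\<dots> \<in> ?A"
    by (intro closed mult least(2) IJ C1)
  finally have C2: "C2 \<in> ?A" .
  have "N = 2 *\<^sub>R (Adj + C1) - J - C2"
    by (simp add: Adj_eq fun_eq_iff)
  also have "\<dots> \<in> ?A"
    by (intro closed least(2) IJ C1 C2)
  finally have "N \<in> ?A" .
  with IJ C1 C2 show "span S \<subseteq> ?A"
    by (intro span_minimal sub) auto
qed

lemma relation_attained: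
  assumes "k \<in> {0, 1, 2, 3, 4}" and "n \<ge> 3"
  shows "\<exists>u\<in>X. \<exists>v\<in>X. relation u v = k"
proof -
  let ?u = "(1, 1, 1) :: nat \<times> nat \<times> nat"
  let ?l = "common_symbol n L 1 2 1 1"
  have mem: "?u \<in> X" "(1, 1, 2) \<in> X" "(1, 2, 1) \<in> X" "\<And>y. y \<in> {1..n} \<Longrightarrow> (2, 1, y) \<in> X"
    using n_ge_2 m_ge_2 \<open>n \<ge> 3\<close> by (auto simp: Omega_def)
  have l: "?l \<in> {2..n}"
    using n_ge_2 m_ge_2 by (intro common_symbol_range[OF mals]) auto
  \<comment> \<open>Relation 3 needs two different entries of the row: if all were equal to 1 or all
    to -1, their sum would not be zero.\<close>
  have "\<exists>y\<in>{1..n}. h ?l 1 \<noteq> h ?l y"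
  proof (rule ccontr)
    assume "\<not> ?thesis"
    then have "(\<Sum>y\<in>{1..n}. h ?l y) = (\<Sum>y\<in>{1..n}. h ?l 1)"
      by (intro sum.cong) auto
    moreover have "h ?l 1 = 1 \<or> h ?l 1 = -1"
      using l n_ge_2 by (intro h_range) auto
    ultimately show False
      using sum_h_row[OF l] n_ge_2 by auto
  qed
  then obtain y where y: "y \<in> {1..n}" "h ?l 1 \<noteq> h ?l y" by blast
  have "relation ?u ?u = 0" "relation ?u (1, 1, 2) = 1" "relation ?u (2, 1, 1) = 2"
    "relation ?u (2, 1, y) = 3" "relation ?u (1, 2, 1) = 4"
    using y(2) by (auto simp: relation_def)
  moreover have "(2, 1, 1) \<in> X" "(2, 1, y) \<in> X"
    using y n_ge_2 by (intro mem(4); simp)+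
  ultimately show ?thesis
    using assms(1) mem(1-3) by blast
qed

lemma coherent_rank_Gamma:
  assumes "real m = real n - 3"
  shows "coherent_rank (Gamma n m H L) = 5"
proof -
  have "n \<ge> 3" using assms m_ge_2 by linarith
  have "coherent_closure (pverts (Gamma n m H L)) (adjacency_matrix (Gamma n m H L)) =
      span (R ` {0, 1, 2, 3, 4})"
    using coherent_closure_eq[OF assms] unfolding span_relation_matrices by (simp add: Gamma_def Adj_def)
  then show ?thesis
    unfolding coherent_rank_def
    by (simp only: dim_span_relation_matrices[OF relation_attained[OF _ \<open>n \<ge> 3\<close>]]) simp
qed


section \<open>The spectrum\<close>

lemma sum_diagonals:
  "(\<Sum>u\<in>X. I u u) = m * ((n - 1) * n)" "(\<Sum>u\<in>X. J u u) = m * ((n - 1) * n)"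
  "(\<Sum>u\<in>X. C1 u u) = m * ((n - 1) * n)" "(\<Sum>u\<in>X. C2 u u) = m * ((n - 1) * n)"
  "(\<Sum>u\<in>X. N u u) = 0"
proof -
  show "(\<Sum>u\<in>X. N u u) = 0"
    by (rule sum.neutral) (auto simp: N_def)
qed (simp_all add: card_X identity_on_def all_ones_on_def C1_def C2_def eq_matrix_def)

text \<open>The projections onto the eigenspaces, with their eigenvalues and ranks.\<close>

definition E :: "nat \<Rightarrow> (nat \<times> nat \<times> nat) matrix" where
  "E k =
    [(1 / (m * (real n - 1) * n)) *\<^sub>R J,
     (1 / ((real n - 1) * n)) *\<^sub>R C2 - (1 / (m * (real n - 1) * n)) *\<^sub>R J,
     (1 / (m * n)) *\<^sub>R (N + real n *\<^sub>R I - C1),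
     (1 / (m * n)) *\<^sub>R ((real m - 1) *\<^sub>R (real n *\<^sub>R I - C1) - N),
     (1 / n) *\<^sub>R C1 - (1 / ((real n - 1) * n)) *\<^sub>R C2] ! k"

definition \<theta> :: "nat \<Rightarrow> real" where
  "\<theta> k = [((real m + 1) * (real n - 1) / 2 - 1) * n, real n * (real n - 3) / 2,
     n * (real m - 1) / 2, - (real n) / 2, - real n] ! k"

definition d :: "nat \<Rightarrow> nat" where
  "d k = [1, m - 1, (n - 1)\<^sup>2, (n - 1)\<^sup>2 * (m - 1), (n - 2) * m] ! k"

lemma has_spectrum_Adj: "has_spectrum X Adj (\<Sum>k\<in>{0, 1, 2, 3, 4}. replicate_mset (d k) (\<theta> k))"
proof (rule has_spectrum_of_eigenmatrices)
  have pos: "real m > 0" "real n > 0" "real n - 1 > 0" "real m \<noteq> 0" "real n \<noteq> 0" "real n - 1 \<noteq> 0" "real n \<noteq> 1"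
    using n_ge_2 m_ge_2 by auto
  have "mmult_on X I Adj = Adj"
    by (rule mmult_on_identity_left) (simp_all add: Adj_in_matrices_on)
  note left = mmult_on_linear(1,3,5) Adj_products this
  \<comment> \<open>Over a common denominator: in the product of \<open>m C2 - J\<close> with
    \<open>Adj\<close> the coefficient of \<open>J\<close> collapses to
    \<open>-n (n - 3) / 2\<close>, as the eigenvalue requires.\<close>
  have E1: "E 1 = (1 / (m * ((real n - 1) * n))) *\<^sub>R (real m *\<^sub>R C2 - J)"
    using pos by (simp add: E_def fun_eq_iff right_diff_distrib mult.assoc)
  have "mmult_on X (E k) Adj = \<theta> k *\<^sub>R E k" if "k \<in> {0, 1, 2, 3, 4}" for k
    using that
  proof (elim insertE emptyE)
    assume "k = 0" then show ?thesis by (simp add: E_def \<theta>_def left)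
  next
    assume "k = 1" then show ?thesis
      by (simp only: E1 left) (simp add: \<theta>_def fun_eq_iff algebra_simps add_divide_distrib diff_divide_distrib)
  next
    assume "k = 2" then show ?thesis
      using pos by (simp add: E_def \<theta>_def left) (simp add: Adj_eq fun_eq_iff field_simps)
  next
    assume "k = 3" then show ?thesis
      using pos by (simp add: E_def \<theta>_def left) (simp add: Adj_eq fun_eq_iff field_simps)
  next
    assume "k = 4" then show ?thesis
      using pos by (simp add: E_def \<theta>_def left) (simp add: fun_eq_iff field_simps)
  qed
  then show "mmult_on X (E k) Adj u v = \<theta> k * E k u v" if "k \<in> {0, 1, 2, 3, 4}" for k u v
    using that by simp
  show "(\<Sum>k\<in>{0, 1, 2, 3, 4}. E k u v) = (if u = v then 1 else 0)" if "u \<in> X" for u v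
  proof -
    \<comment> \<open>The matrices \<open>E 2\<close> and \<open>E 3\<close> sum to
      \<open>I - C1 / n\<close>; the other three telescope to \<open>C1 / n\<close>.\<close>
    have "(N u v + n * I u v - C1 u v) / (m * n) + ((real m - 1) * (n * I u v - C1 u v) - N u v) / (m * n) =
        I u v - C1 u v / n"
      using pos by (simp add: field_simps)
    then have "(\<Sum>k\<in>{0, 1, 2, 3, 4}. E k u v) = I u v"
      by (simp add: E_def)
    then show ?thesis using that by (auto simp: identity_on_def)
  qed
  have nat: "real (n - 1) = real n - 1" "real (n - 2) = real n - 2" "real (m - 1) = real m - 1"
    using n_ge_2 m_ge_2 by (simp_all add: of_nat_diff)
  \<comment> \<open>\<open>I\<close>, \<open>J\<close>, \<open>C1\<close>, \<open>C2\<close> have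
    diagonal entries 1 and \<open>N\<close> has zero diagonal, so each trace is
    \<open>card X\<close> times a sum of coefficients.\<close>
  show "(\<Sum>u\<in>X. E k u u) = real (d k)" if "k \<in> {0, 1, 2, 3, 4}" for k
    using that pos
    by (elim insertE emptyE)
      (simp_all add: E_def d_def sum_subtractf sum.distrib sum_diagonals nat
        flip: sum_distrib_left sum_divide_distrib, simp_all add: field_simps power2_eq_square)
qed simp

lemma has_spectrum_Gamma:
  assumes m: "m = n - 3" and "n \<ge> 4"
  shows "has_spectrum (pverts (Gamma n m H L)) (adjacency_matrix (Gamma n m H L))
    (replicate_mset 1 ((real n)\<^sup>2 * (real n - 3) / 2)
     + replicate_mset (n - 4) (real n * (real n - 3) / 2)
     + replicate_mset ((n - 1)\<^sup>2) (real n * (real n - 4) / 2)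
     + replicate_mset ((n - 1)\<^sup>2 * (n - 4)) (- (real n) / 2)
     + replicate_mset ((n - 2) * (n - 3)) (- real n))"
proof -
  have rm: "real m = real n - 3" and m1: "m - 1 = n - 4"
    using assms by (auto simp: of_nat_diff)
  have th: "\<theta> 0 = (real n)\<^sup>2 * (real n - 3) / 2" "\<theta> 1 = real n * (real n - 3) / 2"
    "\<theta> 2 = real n * (real n - 4) / 2" "\<theta> 3 = - (real n) / 2" "\<theta> 4 = - real n"
    unfolding \<theta>_def rm by (simp_all add: field_simps power2_eq_square)
  have dd: "d 0 = 1" "d 1 = n - 4" "d 2 = (n - 1)\<^sup>2" "d 3 = (n - 1)\<^sup>2 * (n - 4)" "d 4 = (n - 2) * (n - 3)"
    unfolding d_def m1 by (simp_all add: m)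
  have "(\<Sum>k\<in>{0, 1, 2, 3, 4}. replicate_mset (d k) (\<theta> k)) =
    replicate_mset (d 0) (\<theta> 0) + replicate_mset (d 1) (\<theta> 1) + replicate_mset (d 2) (\<theta> 2)
    + replicate_mset (d 3) (\<theta> 3) + replicate_mset (d 4) (\<theta> 4)"
    by (simp add: add.assoc)
  with has_spectrum_Adj show ?thesis
    unfolding dd th by (simp add: Gamma_def Adj_def)
qed


section \<open>The regular clique\<close>

lemma Adj_arcs: "Adj u v = (if (u, v) \<in> parcs (Gamma n m H L) then 1 else 0)"
  by (simp add: Adj_def adjacency_matrix_def)

lemma arcs_iff: "(u, v) \<in> parcs (Gamma n m H L) \<longleftrightarrow> Adj u v = 1"
  by (simp add: Adj_arcs)

lemma pverts_Gamma: "pverts (Gamma n m H L) = X"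
  by (simp add: Gamma_def)

lemma arcs_in_X: "(u, v) \<in> parcs (Gamma n m H L) \<Longrightarrow> u \<in> X \<and> v \<in> X"
  by (auto simp: Gamma_def)

lemma Adj_entry:
  assumes "(i, r, x) \<in> X" "(j, s, y) \<in> X"
  shows "Adj (i, r, x) (j, s, y) =
    (if i = j then if r = s then 0 else 1 else (1 + N (i, r, x) (j, s, y)) / 2)"
  using assms by (auto simp: Adj_eq entries N_def)

text \<open>The degree is a row sum of \<open>Adj\<close>, by symmetry a column sum, and hence a
  diagonal entry of \<open>J\<close> times \<open>Adj\<close>.\<close>

lemma card_neighbours:
  assumes "u \<in> X"
  shows "real (card {v \<in> X. (u, v) \<in> parcs (Gamma n m H L)}) = ((real m + 1) * (real n - 1) / 2 - 1) * n"
proof -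
  have "real (card {v \<in> X. (u, v) \<in> parcs (Gamma n m H L)}) = (\<Sum>v\<in>X. Adj u v)"
    by (simp add: Adj_arcs sum.If_cases Int_def)
  also have "\<dots> = (\<Sum>v\<in>X. J u v * Adj v u)"
    using assms symmetric(5) by (intro sum.cong) (auto simp: all_ones_on_def)
  also have "\<dots> = mmult_on X J Adj u u"
    by (simp add: mmult_on_def)
  finally show ?thesis
    using assms by (simp add: Adj_products) (simp add: all_ones_on_def)
qed

text \<open>The count is the \<open>(u, v)\<close> entry of \<open>Adj\<close> squared. On an arc
  \<open>J\<close> and \<open>Adj\<close> are 1 while \<open>C1\<close> and \<open>I\<close> vanish,
  which leaves \<open>n (n - 1) (n - 2) / 4 + n (n - 5) / 2\<close>.\<close>

lemma card_common_neighbours: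
  assumes uv: "(u, v) \<in> parcs (Gamma n m H L)" and m: "real m = real n - 3"
  shows "real (card {w \<in> X. (u, w) \<in> parcs (Gamma n m H L) \<and> (v, w) \<in> parcs (Gamma n m H L)}) =
    real n * ((real n)\<^sup>2 - real n - 8) / 4"
proof -
  have X: "u \<in> X" "v \<in> X" using arcs_in_X[OF uv] by auto
  have "real (card {w \<in> X. (u, w) \<in> parcs (Gamma n m H L) \<and> (v, w) \<in> parcs (Gamma n m H L)}) =
      (\<Sum>w\<in>X. if (u, w) \<in> parcs (Gamma n m H L) \<and> (v, w) \<in> parcs (Gamma n m H L) then 1 else 0)"
    by (simp add: sum.If_cases Int_def)
  also have "\<dots> = mmult_on X Adj Adj u v"
    unfolding mmult_on_def by (intro sum.cong refl) (simp add: Adj_arcs[of u] symmetric(5)[of _ v] Adj_arcs[of v])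
  also have "\<dots> = real n * ((real n)\<^sup>2 - real n - 8) / 4"
  proof -
    obtain i r x j s y where tuples: "u = (i, r, x)" "v = (j, s, y)" by (cases u; cases v)
    have "Adj u v = 1" using uv by (simp add: arcs_iff)
    moreover have "J u v = 1" "C1 u v = 0" "I u v = 0"
      using X \<open>Adj u v = 1\<close> unfolding tuples by (auto simp: entries Adj_entry split: if_splits)
    ultimately show ?thesis
      by (simp add: Adj_square[OF m] field_simps power2_eq_square)
  qed
  finally show ?thesis .
qed

lemma pair_graph_Gamma: "pair_graph (Gamma n m H L)"
proof
  show "finite (pverts (Gamma n m H L))" by (simp add: pverts_Gamma)
  have "parcs (Gamma n m H L) \<subseteq> X \<times> X" using arcs_in_X by auto
  then show "finite (parcs (Gamma n m H L))" by (rule finite_subset) simp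
  show "Digraph.symmetric (with_proj (Gamma n m H L))"
    by (auto simp: symmetric_def arcs_ends_def arc_to_ends_def arcs_iff symmetric(5) intro!: symI)
next
  fix e assume arc: "e \<in> parcs (Gamma n m H L)"
  obtain i r x j s y where e: "e = ((i, r, x), (j, s, y))" by (metis prod_cases3 surj_pair)
  have X: "(i, r, x) \<in> X" "(j, s, y) \<in> X" and "Adj (i, r, x) (j, s, y) = 1"
    using arc arcs_in_X unfolding e by (auto simp: Adj_arcs)
  then show "fst e \<in> pverts (Gamma n m H L)" "snd e \<in> pverts (Gamma n m H L)" "fst e \<noteq> snd e"
    unfolding e by (auto simp: pverts_Gamma Adj_entry)
qed

section \<open>The clique of vertices with last coordinate 1\<close>

definition clique :: "(nat \<times> nat \<times> nat) set" where
  "clique = {1..m} \<times> {1..n - 1} \<times> {1}"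

text \<open>In different squares the entry of \<open>N\<close> is the square of \<open>h a 1\<close>
  for the common symbol \<open>a\<close>, hence 1; within one square, distinct rows are joined by
  \<open>A4\<close>.\<close>

lemma clique_adjacent:
  assumes "u \<in> clique" "v \<in> clique" "u \<noteq> v"
  shows "(u, v) \<in> parcs (Gamma n m H L)"
proof -
  obtain i r j s where u: "u = (i, r, 1)" "v = (j, s, 1)"
    using assms by (auto simp: clique_def)
  have X: "u \<in> X" "v \<in> X" using assms n_ge_2 by (auto simp: clique_def Omega_def)
  have "N u v = 1" if "i \<noteq> j"
  proof -
    let ?l = "common_symbol n L i j r s"
    have "?l \<in> {2..n}"
      using X that by (intro common_symbol_range[OF mals]) (auto simp: u Omega_def)
    then have "h ?l 1 = 1 \<or> h ?l 1 = -1"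
      using n_ge_2 by (intro h_range) auto
    then show ?thesis using that X by (auto simp: N_def u)
  qed
  then show ?thesis
    using assms(3) X unfolding arcs_iff u by (auto simp: Adj_entry)
qed

text \<open>For fixed \<open>k\<close> each symbol \<open>a\<close> matches exactly one row
  \<open>q\<close>. The sum is therefore that of \<open>h a x * h a y\<close> over
  \<open>a \<ge> 2\<close>, which is 0 - 1 by column orthogonality.\<close>

lemma N_column_sum:
  assumes "(i, r, x) \<in> X" "k \<in> {1..m}" "y \<in> {1..n}" "i \<noteq> k" "x \<noteq> y"
  shows "(\<Sum>q\<in>{1..n - 1}. N (i, r, x) (k, q, y)) = -1"
proof -
  have mem: "i \<in> {1..m}" "r \<in> {1..n - 1}" "x \<in> {1..n}"
    using assms by (auto simp: Omega_def)
  have "(\<Sum>q\<in>{1..n - 1}. K a (i, r) (k, q)) = 1" if "a \<in> {2..n}" for a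
  proof -
    from row_ex1[OF assms(2) col_props(1)[OF mem(1,2) that] that]
    obtain q0 where q0: "q0 \<in> {1..n - 1}" "\<And>q. q \<in> {1..n - 1} \<Longrightarrow> col k q a = col i r a \<longleftrightarrow> q = q0"
      by metis
    have "(\<Sum>q\<in>{1..n - 1}. K a (i, r) (k, q)) = (\<Sum>q\<in>{1..n - 1}. if q = q0 then 1 else 0)"
    proof (rule sum.cong)
      fix q assume "q \<in> {1..n - 1}"
      from q0(2)[OF this] show "K a (i, r) (k, q) = (if q = q0 then 1 else 0)"
        using assms(4) by (auto simp: K_def)
    qed simp
    with q0(1) show ?thesis by simp
  qed
  moreover have "(\<Sum>q\<in>{1..n - 1}. N (i, r, x) (k, q, y)) =
      (\<Sum>q\<in>{1..n - 1}. \<Sum>a\<in>{2..n}. K a (i, r) (k, q) * (h a x * h a y))"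
    using assms by (intro sum.cong refl N_eq_sum) (auto simp: Omega_def)
  moreover have "\<dots> = (\<Sum>a\<in>{2..n}. (\<Sum>q\<in>{1..n - 1}. K a (i, r) (k, q)) * (h a x * h a y))"
    by (subst sum.swap) (simp add: sum_distrib_right)
  ultimately have "(\<Sum>q\<in>{1..n - 1}. N (i, r, x) (k, q, y)) = (\<Sum>a\<in>{2..n}. h a x * h a y)"
    by simp
  also have "\<dots> = -1"
    using sum_h_symbols[OF mem(3) assms(3)] assms(5) by simp
  finally show ?thesis .
qed

text \<open>The square of \<open>u\<close> contributes its \<open>n - 2\<close> other rows. Each of
  the \<open>m - 1\<close> other squares contributes \<open>((n - 1) - 1) / 2\<close> by
  \<open>N_column_sum\<close>, as the last coordinate of \<open>u\<close> is not 1.\<close>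

lemma card_clique_neighbours:
  assumes "u \<in> X - clique"
  shows "real (card {v \<in> clique. (u, v) \<in> parcs (Gamma n m H L)}) = (real m + 1) * (real n - 2) / 2"
proof -
  obtain i r x where u: "u = (i, r, x)" by (cases u)
  have mem: "i \<in> {1..m}" "r \<in> {1..n - 1}" "x \<noteq> 1" and uX: "(i, r, x) \<in> X"
    using assms by (auto simp: u Omega_def clique_def)
  have X: "(k, q, 1) \<in> X" if "k \<in> {1..m}" "q \<in> {1..n - 1}" for k q
    using that n_ge_2 by (auto simp: Omega_def)
  have "finite clique" by (simp add: clique_def)
  then have "real (card {v \<in> clique. (u, v) \<in> parcs (Gamma n m H L)}) = (\<Sum>v\<in>clique. Adj u v)"
    by (simp add: Adj_arcs sum.If_cases Int_def)
  also have "\<dots> = (\<Sum>k\<in>{1..m}. \<Sum>q\<in>{1..n - 1}. Adj u (k, q, 1))"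
  proof -
    have "(\<Sum>v\<in>clique. Adj u v) = (\<Sum>k\<in>{1..m}. \<Sum>q\<in>{1..n - 1}. \<Sum>z\<in>{1}. Adj u (k, q, z))"
      unfolding clique_def sum.cartesian_product by (rule sum.cong) auto
    then show ?thesis by simp
  qed
  also have "\<dots> = (\<Sum>k\<in>{1..m}. if k = i then real n - 2 else (real n - 2) / 2)"
  proof (rule sum.cong[OF refl])
    fix k assume k: "k \<in> {1..m}"
    show "(\<Sum>q\<in>{1..n - 1}. Adj u (k, q, 1)) = (if k = i then real n - 2 else (real n - 2) / 2)"
    proof (cases "k = i")
      case True
      have "(\<Sum>q\<in>{1..n - 1}. Adj u (k, q, 1)) = (\<Sum>q\<in>{1..n - 1}. 1 - (if q = r then 1 else 0))"
        by (rule sum.cong) (use uX X k True in \<open>auto simp: u Adj_entry\<close>)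
      with True mem n_ge_2 show ?thesis by (simp add: sum_subtractf of_nat_diff)
    next
      case False
      have "(\<Sum>q\<in>{1..n - 1}. Adj u (k, q, 1)) = (\<Sum>q\<in>{1..n - 1}. (1 + N (i, r, x) (k, q, 1)) / 2)"
        by (rule sum.cong) (use uX X k False in \<open>auto simp: u Adj_entry\<close>)
      also have "\<dots> = (real (n - 1) + (\<Sum>q\<in>{1..n - 1}. N (i, r, x) (k, q, 1))) / 2"
        by (simp add: sum.distrib flip: sum_divide_distrib)
      also have "(\<Sum>q\<in>{1..n - 1}. N (i, r, x) (k, q, 1)) = -1"
        by (rule N_column_sum[OF uX k]) (use False mem n_ge_2 in auto)
      finally show ?thesis using False n_ge_2 by (simp add: of_nat_diff)
    qed
  qed
  also have "\<dots> = (\<Sum>k\<in>{1..m}. (real n - 2) / 2 + (if k = i then (real n - 2) / 2 else 0))"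
    by (rule sum.cong) auto
  also have "\<dots> = (real m + 1) * (real n - 2) / 2"
    using mem by (simp add: sum.distrib) (simp add: field_simps)
  finally show ?thesis .
qed

lemma neumaier_graph_Gamma:
  assumes m: "m = n - 3" and n: "n \<ge> 4"
  shows "\<exists>v k l e s :: nat.
            neumaier_graph (Gamma n m H L) v k l e s \<and>
            real v = real n * (real n - 1) * (real n - 3) \<and>
            real k = (real n)\<^sup>2 * (real n - 3) / 2 \<and>
            real l = real n * ((real n)\<^sup>2 - real n - 8) / 4 \<and>
            real e = (real n - 2)\<^sup>2 / 2 \<and>
            real s = (real n - 1) * (real n - 3)"
proof -
  let ?G = "Gamma n m H L"
  have rm: "real m = real n - 3" using m n by (simp add: of_nat_diff)
  \<comment> \<open>\<open>u0\<close> and \<open>u1\<close> form an arc; \<open>u2\<close> lies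
    outside the clique and in the same block as \<open>u0\<close>, hence is not adjacent to
    \<open>u0\<close>.\<close>
  define u0 u1 u2 :: "nat \<times> nat \<times> nat" where "u0 = (1, 1, 1)" and "u1 = (1, 2, 1)" and "u2 = (1, 1, 2)"
  have mem: "u0 \<in> X" "u1 \<in> X" "u2 \<in> X - clique" "u0 \<in> clique" "u1 \<in> clique"
    using n m_ge_2 by (auto simp: u0_def u1_def u2_def Omega_def clique_def)
  have arc: "(u0, u1) \<in> parcs ?G"
    using mem by (intro clique_adjacent) (simp_all add: u0_def u1_def)
  \<comment> \<open>The parameters are taken as cardinalities at sample vertices, so no divisibility
    has to be shown; the real-valued counts show that they do not depend on the sample.\<close>
  define k where "k = card {v \<in> X. (u0, v) \<in> parcs ?G}"
  define l where "l = card {w \<in> X. (u0, w) \<in> parcs ?G \<and> (u1, w) \<in> parcs ?G}"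
  define e where "e = card {v \<in> clique. (u2, v) \<in> parcs ?G}"
  have k: "card {v \<in> X. (u, v) \<in> parcs ?G} = k" if "u \<in> X" for u
    using card_neighbours[OF that] card_neighbours[OF mem(1)] unfolding k_def by linarith
  have l: "card {w \<in> X. (u, w) \<in> parcs ?G \<and> (v, w) \<in> parcs ?G} = l" if "(u, v) \<in> parcs ?G" for u v
    using card_common_neighbours[OF that rm] card_common_neighbours[OF arc rm] unfolding l_def by linarith
  have e: "card {v \<in> clique. (u, v) \<in> parcs ?G} = e" if "u \<in> X - clique" for u
    using card_clique_neighbours[OF that] card_clique_neighbours[OF mem(3)] unfolding e_def by linarith
  have real_e: "real e = (real n - 2)\<^sup>2 / 2"
    using card_clique_neighbours[OF mem(3)] by (simp add: e_def rm power2_eq_square)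
  have "edge_regular ?G (card X) k l"
    unfolding edge_regular_def pverts_Gamma using pair_graph_Gamma k l by auto
  moreover have "\<not> complete_graph ?G"
  proof -
    have "Adj u0 u2 = 0"
      using mem by (simp add: u0_def u2_def Adj_entry)
    then have "(u0, u2) \<notin> parcs ?G" "u0 \<noteq> u2"
      by (simp_all add: arcs_iff u0_def u2_def)
    then show ?thesis using mem unfolding complete_graph_def pverts_Gamma by blast
  qed
  moreover have "regular_clique ?G e (card clique) clique"
    unfolding regular_clique_def pverts_Gamma
  proof (intro conjI ballI impI)
    show "clique \<subset> X"
      using mem(3) n by (auto simp: clique_def Omega_def)
    show "clique \<noteq> {}" using mem(4) by blast
    have "real e > 0" using n by (simp add: real_e)
    then show "e > 0" by simp
  qed (use clique_adjacent e in auto)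
  ultimately have "neumaier_graph ?G (card X) k l e (card clique)"
    unfolding neumaier_graph_def by blast
  moreover have "real (card X) = real n * (real n - 1) * (real n - 3)"
    using n_ge_2 by (simp add: card_X rm of_nat_diff)
  moreover have "real k = (real n)\<^sup>2 * (real n - 3) / 2"
    using card_neighbours[OF mem(1)] by (simp add: k_def rm field_simps power2_eq_square)
  moreover have "real l = real n * ((real n)\<^sup>2 - real n - 8) / 4"
    using card_common_neighbours[OF arc rm] by (simp add: l_def)
  moreover have "real (card clique) = (real n - 1) * (real n - 3)"
    using n_ge_2 by (simp add: clique_def card_cartesian_product rm of_nat_diff)
  ultimately show ?thesis using real_e by blast
qed

end

theorem theorem4p3:
  fixes n :: nat and H :: "real mat" and L :: "nat \<Rightarrow> nat \<Rightarrow> nat \<Rightarrow> nat"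
  assumes "n \<ge> 8"
    and "hadamard_matrix n H"
    and "row H 0 = vec n (\<lambda>_. 1)"
    and "MALS n (n - 3) L"
  shows "(\<exists>v k l e s :: nat.
            neumaier_graph (Gamma n (n - 3) H L) v k l e s \<and>
            real v = real n * (real n - 1) * (real n - 3) \<and>
            real k = (real n)\<^sup>2 * (real n - 3) / 2 \<and>
            real l = real n * ((real n)\<^sup>2 - real n - 8) / 4 \<and>
            real e = (real n - 2)\<^sup>2 / 2 \<and>
            real s = (real n - 1) * (real n - 3))
       \<and> coherent_rank (Gamma n (n - 3) H L) = 5
       \<and> has_spectrum (pverts (Gamma n (n - 3) H L)) (adjacency_matrix (Gamma n (n - 3) H L))
            (replicate_mset 1 ((real n)\<^sup>2 * (real n - 3) / 2)
             + replicate_mset (n - 4) (real n * (real n - 3) / 2)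
             + replicate_mset ((n - 1)\<^sup>2) (real n * (real n - 4) / 2)
             + replicate_mset ((n - 1)\<^sup>2 * (n - 4)) (- (real n) / 2)
             + replicate_mset ((n - 2) * (n - 3)) (- real n))"
proof -
  interpret hadamard_mals n "n - 3" H L
    using assms by unfold_locales auto
  have "real (n - 3) = real n - 3" "n \<ge> 4"
    using assms(1) by (simp_all add: of_nat_diff)
  then show ?thesis
    by (intro conjI neumaier_graph_Gamma coherent_rank_Gamma has_spectrum_Gamma refl)
qed

end
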